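(* Let $p \in (1,2)$ and let $A \in \mathbb{R}^{n \times d}$ have full column rank. Let $\Pi \in \mathbb{R}^{s \times n}$ have i.i.d. entries drawn from $\mathcal{D}_p$. If $s = \omega d \log d$ with $\omega$ sufficiently large, then with a constant probability, $$\frac{1}{O(1)}\|Ax\|_p \le \|\Pi A x\|_p \le O((d\log d)^{1/p})\,\|Ax\|_p \quad \text{for all } x \in \mathbb{R}^d.$$ In addition, $\Pi A$ can be computed in $O(\mathrm{nnz}(A)\cdot d\log d)$ time.
   Context: $\mathcal{D}_p$ denotes the standard $p$-stable distribution, i.e. the distribution on $\mathbb{R}$ with characteristic function $e^{-|t|^p}$. $\mathrm{nnz}(A)$ is the number of nonzero entries of $A$.
   Formalization: The norm inequalities are for the rescaled sketch s^{-1/p}Π, since for unscaled i.i.d. D_p entries the upper bound fails as d grows (E|X|^p is infinite for p<2); also d ≥ 2, s = ⌈ω d ln d⌉, and the constants may depend on p and ω. *)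

theory Defs
  imports "HOL-Probability.Probability" "Jordan_Normal_Form.DL_Rank"
begin

text \<open>Matrices are those of Jordan_Normal_Form, so that the dimensions are ordinary natural
  numbers and can be quantified inside a formula.\<close>

definition lp_norm :: "real \<Rightarrow> real vec \<Rightarrow> real" where
  "lp_norm p v = (\<Sum>i<dim_vec v. \<bar>vec_index v i\<bar> powr p) powr (1 / p)"

definition nonzero_entries :: "real mat \<Rightarrow> (nat \<times> nat) set" where
  "nonzero_entries A = {(i, j). i < dim_row A \<and> j < dim_col A \<and> A $$ (i, j) \<noteq> 0}"

definition nnz :: "real mat \<Rightarrow> nat" where
  "nnz A = card (nonzero_entries A)"

text \<open>By uniqueness of characteristic functions at most one \<open>D\<close> satisfies this for a given \<open>p\<close>.\<close>

definition standard_stable :: "real \<Rightarrow> real measure \<Rightarrow> bool" where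
  "standard_stable p D \<longleftrightarrow>
     real_distribution D \<and> (\<forall>t. char D t = complex_of_real (exp (- (\<bar>t\<bar> powr p))))"

text \<open>The joint law of the entries of an \<open>s \<times> n\<close> matrix with i.i.d. entries of law \<open>D\<close>; a sample
  point \<open>g\<close> stands for the matrix \<open>mat s n g\<close>. The entries are not rescaled: a factor \<open>s powr (- 1 / p)\<close>
  that normalizes the sketch has to be written separately.\<close>

definition iid_entries :: "real measure \<Rightarrow> nat \<Rightarrow> nat \<Rightarrow> (nat \<times> nat \<Rightarrow> real) measure" where
  "iid_entries D s n = Pi\<^sub>M ({..<s} \<times> {..<n}) (\<lambda>_. D)"

text \<open>
  Running time is measured on a unit-cost real RAM, programmed in a structured language. There
  are registers holding natural numbers, registers holding reals, and for each type a family of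
  two-dimensional arrays, whose names are constants of the program and whose cells are addressed
  by the contents of two index registers. Every instruction and every evaluation of a branching
  condition costs one step. Index arithmetic is limited to addition and truncated subtraction,
  which prevents very large integers from being used as free parallel storage.
\<close>

datatype ram_guard =
    ILess nat nat
  | RLess nat nat

datatype ram_prog =
    IConst nat nat
  | IAdd nat nat nat
  | ISub nat nat nat
  | ILoad nat nat nat nat
  | IStore nat nat nat nat
  | RConst nat rat
  | RAdd nat nat nat
  | RSub nat nat nat
  | RMul nat nat nat
  | RDiv nat nat nat
  | RLoad nat nat nat nat
  | RStore nat nat nat nat
  | Seq ram_prog ram_prog
  | If ram_guard ram_prog ram_prog
  | While ram_guard ram_prog

record ram_state =
  ireg :: "nat \<Rightarrow> nat"
  rreg :: "nat \<Rightarrow> real"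
  iarr :: "nat \<Rightarrow> nat \<Rightarrow> nat \<Rightarrow> nat"
  rarr :: "nat \<Rightarrow> nat \<Rightarrow> nat \<Rightarrow> real"

fun guard_holds :: "ram_guard \<Rightarrow> ram_state \<Rightarrow> bool" where
  "guard_holds (ILess a b) \<sigma> \<longleftrightarrow> ireg \<sigma> a < ireg \<sigma> b"
| "guard_holds (RLess a b) \<sigma> \<longleftrightarrow> rreg \<sigma> a < rreg \<sigma> b"

definition set_ireg :: "nat \<Rightarrow> nat \<Rightarrow> ram_state \<Rightarrow> ram_state" where
  "set_ireg r v \<sigma> = \<sigma>\<lparr>ireg := (ireg \<sigma>)(r := v)\<rparr>"

definition set_rreg :: "nat \<Rightarrow> real \<Rightarrow> ram_state \<Rightarrow> ram_state" where
  "set_rreg r v \<sigma> = \<sigma>\<lparr>rreg := (rreg \<sigma>)(r := v)\<rparr>"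

definition set_icell :: "nat \<Rightarrow> nat \<Rightarrow> nat \<Rightarrow> nat \<Rightarrow> ram_state \<Rightarrow> ram_state" where
  "set_icell k i j v \<sigma> =
     \<sigma>\<lparr>iarr := (iarr \<sigma>)(k := (iarr \<sigma> k)(i := (iarr \<sigma> k i)(j := v)))\<rparr>"

definition set_rcell :: "nat \<Rightarrow> nat \<Rightarrow> nat \<Rightarrow> real \<Rightarrow> ram_state \<Rightarrow> ram_state" where
  "set_rcell k i j v \<sigma> =
     \<sigma>\<lparr>rarr := (rarr \<sigma>)(k := (rarr \<sigma> k)(i := (rarr \<sigma> k i)(j := v)))\<rparr>"

text \<open>\<open>ram_exec P \<sigma> t \<tau>\<close>: started in \<open>\<sigma>\<close>, the program \<open>P\<close> halts in \<open>\<tau>\<close> after \<open>t\<close> steps.\<close>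

inductive ram_exec :: "ram_prog \<Rightarrow> ram_state \<Rightarrow> nat \<Rightarrow> ram_state \<Rightarrow> bool" where
  "ram_exec (IConst r c) \<sigma> 1 (set_ireg r c \<sigma>)"
| "ram_exec (IAdd r a b) \<sigma> 1 (set_ireg r (ireg \<sigma> a + ireg \<sigma> b) \<sigma>)"
| "ram_exec (ISub r a b) \<sigma> 1 (set_ireg r (ireg \<sigma> a - ireg \<sigma> b) \<sigma>)"
| "ram_exec (ILoad r k a b) \<sigma> 1 (set_ireg r (iarr \<sigma> k (ireg \<sigma> a) (ireg \<sigma> b)) \<sigma>)"
| "ram_exec (IStore k a b r) \<sigma> 1 (set_icell k (ireg \<sigma> a) (ireg \<sigma> b) (ireg \<sigma> r) \<sigma>)"
| "ram_exec (RConst r q) \<sigma> 1 (set_rreg r (of_rat q) \<sigma>)"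
| "ram_exec (RAdd r a b) \<sigma> 1 (set_rreg r (rreg \<sigma> a + rreg \<sigma> b) \<sigma>)"
| "ram_exec (RSub r a b) \<sigma> 1 (set_rreg r (rreg \<sigma> a - rreg \<sigma> b) \<sigma>)"
| "ram_exec (RMul r a b) \<sigma> 1 (set_rreg r (rreg \<sigma> a * rreg \<sigma> b) \<sigma>)"
| "ram_exec (RDiv r a b) \<sigma> 1 (set_rreg r (rreg \<sigma> a / rreg \<sigma> b) \<sigma>)"
| "ram_exec (RLoad r k a b) \<sigma> 1 (set_rreg r (rarr \<sigma> k (ireg \<sigma> a) (ireg \<sigma> b)) \<sigma>)"
| "ram_exec (RStore k a b r) \<sigma> 1 (set_rcell k (ireg \<sigma> a) (ireg \<sigma> b) (rreg \<sigma> r) \<sigma>)"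
| "ram_exec P \<sigma> t \<sigma>' \<Longrightarrow> ram_exec Q \<sigma>' u \<tau> \<Longrightarrow> ram_exec (Seq P Q) \<sigma> (t + u) \<tau>"
| "guard_holds g \<sigma> \<Longrightarrow> ram_exec P \<sigma> t \<tau> \<Longrightarrow> ram_exec (If g P Q) \<sigma> (t + 1) \<tau>"
| "\<not> guard_holds g \<sigma> \<Longrightarrow> ram_exec Q \<sigma> t \<tau> \<Longrightarrow> ram_exec (If g P Q) \<sigma> (t + 1) \<tau>"
| "guard_holds g \<sigma> \<Longrightarrow> ram_exec P \<sigma> t \<sigma>' \<Longrightarrow> ram_exec (While g P) \<sigma>' u \<tau> \<Longrightarrow>
     ram_exec (While g P) \<sigma> (t + u + 1) \<tau>"
| "\<not> guard_holds g \<sigma> \<Longrightarrow> ram_exec (While g P) \<sigma> 1 \<sigma>"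

text \<open>
  The input of the multiplication \<open>S * A\<close>: the sparse matrix \<open>A\<close> in coordinate format, that is, a
  list \<open>L\<close> of the positions of its nonzero entries (index array 0) with their values (real array
  0), and the dense matrix \<open>S\<close> (real array 1). The dimensions and the length of \<open>L\<close> are in index
  registers 0 to 3, and everything else is zero.
\<close>

definition mult_input :: "real mat \<Rightarrow> real mat \<Rightarrow> (nat \<times> nat) list \<Rightarrow> ram_state" where
  "mult_input S A L = \<lparr>
     ireg = (\<lambda>r. if r = 0 then dim_row S else if r = 1 then dim_row A
                 else if r = 2 then dim_col A else if r = 3 then length L else 0),
     rreg = (\<lambda>_. 0),
     iarr = (\<lambda>k i j. if k = 0 \<and> i < length L \<and> j = 0 then fst (L ! i)
                     else if k = 0 \<and> i < length L \<and> j = 1 then snd (L ! i) else 0),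
     rarr = (\<lambda>k i j. if k = 0 \<and> i < length L \<and> j = 0 then A $$ (L ! i)
                     else if k = 1 \<and> i < dim_row S \<and> j < dim_col S then S $$ (i, j) else 0)\<rparr>"

text \<open>\<open>P\<close> leaves the product \<open>S * A\<close> in real array 2 after at most \<open>T\<close> steps, whatever the order
  in which the nonzero entries of \<open>A\<close> are listed.\<close>

definition multiplies_within :: "ram_prog \<Rightarrow> real mat \<Rightarrow> real mat \<Rightarrow> real \<Rightarrow> bool" where
  "multiplies_within P S A T \<longleftrightarrow>
     (\<forall>L. distinct L \<and> set L = nonzero_entries A \<longrightarrow>
       (\<exists>t \<tau>. ram_exec P (mult_input S A L) t \<tau> \<and> real t \<le> T \<and>
         (\<forall>i<dim_row S. \<forall>j<dim_col A. rarr \<tau> 2 i j = (S * A) $$ (i, j))))"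

end

theory Submission
  imports Defs
begin

text \<open>The range of \<open>A\<close> is also the range of some \<open>U\<close> of the same shape whose rows satisfy
  \<open>\<Sum>\<^sub>i \<parallel>u\<^sub>i\<parallel>\<^sub>2\<^sup>p \<le> d\<close> and \<open>\<parallel>y\<parallel>\<^sub>2 \<le> O(1) \<parallel>U y\<parallel>\<^sub>p\<close>. Hence \<open>\<parallel>\<Pi> U y\<parallel>\<^sub>p\<close> is controlled by \<open>\<Sum>\<^sub>k \<parallel>(\<Pi> U)\<^sub>k\<parallel>\<^sub>2\<^sup>p\<close>;
  each summand has a weak \<open>L\<^sub>1\<close> tail of size \<open>d\<close>, so the sum of \<open>s\<close> of them is \<open>O(s d log s)\<close> with constant
  probability, which is the dilation bound. For a single \<open>y\<close> the Laplace transform of the \<open>p\<close>-th power of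
  a stable variable shows that \<open>\<parallel>\<Pi> U y\<parallel>\<^sub>p\<^sup>p < \<kappa> s \<parallel>U y\<parallel>\<^sub>p\<^sup>p\<close> has probability at most \<open>exp (- \<kappa> s)\<close>; a union
  bound over a lattice with \<open>exp (O(d log d))\<close> points, fine enough for the dilation bound to absorb the rounding
  error, gives the contraction bound for all \<open>y\<close>. All estimates are made for \<open>p\<close>-th powers of norms, where
  \<open>\<bar>a + b\<bar>\<^sup>p \<le> 4 (\<bar>a\<bar>\<^sup>p + \<bar>b\<bar>\<^sup>p)\<close> replaces Minkowski's inequality.\<close>

subsection \<open>Sparse multiplication on the RAM\<close>

text \<open>The two bounds call for different methods because the \<open>p\<close>-th power of a
  \<open>p\<close>-stable variable with \<open>p < 2\<close> has infinite expectation. Heavy tails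
  do no harm to the lower bound: \<open>exp (- (\<bar>X\<bar> powr p))\<close> is bounded, so
  failure at one point is exponentially unlikely in \<open>s\<close> and a union bound is
  affordable. The upper bound can fail with constant probability, which rules out a union bound. It
  is therefore reduced to one scalar that dominates all directions, and the infinite mean of its
  summands is cut off at dyadic levels; the number of levels is the factor \<open>log s\<close>.

  The union bound decides the size of \<open>s\<close>: a lattice fine enough for a dilation of
  order \<open>d log d\<close> has polynomially many points in \<open>d\<close> per coordinate,
  hence \<open>exp (O(d log d))\<close> in all, and the exponent \<open>\<kappa> s\<close> has to
  exceed this. Enlarging \<open>\<omega>\<close> also worsens the dilation and refines the lattice,
  but this enters only through \<open>ln \<omega>\<close>, so a large \<open>\<omega>\<close> wins.
  The two failure probabilities are at most \<open>1 / 2\<close> and \<open>1 / 4\<close>, which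
  leaves \<open>1 / 4\<close>.\<close>

text \<open>Index registers: 4 is the position in the list of entries, 5 holds the constant 1, 6 and 7 the row
  and column of the current entry, 8 runs through the rows of the product, and 9 is never written and
  hence holds 0. Real register 0 holds the current entry.\<close>

definition add_multiple_prog :: ram_prog where
  "add_multiple_prog =
     While (ILess 8 0)
       (Seq (RLoad 1 1 8 6) (Seq (RMul 1 1 0) (Seq (RLoad 2 2 8 7) (Seq (RAdd 2 2 1)
         (Seq (RStore 2 8 7 2) (IAdd 8 8 5))))))"

definition sparse_mult_prog :: ram_prog where
  "sparse_mult_prog =
     Seq (IConst 5 1)
       (While (ILess 4 3)
         (Seq (ILoad 6 0 4 9) (Seq (ILoad 7 0 4 5) (Seq (RLoad 0 0 4 9) (Seq (IConst 8 0)
           (Seq add_multiple_prog (IAdd 4 4 5)))))))"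

lemmas ram_set_defs = set_ireg_def set_rreg_def set_icell_def set_rcell_def

text \<open>An iteration costs 7 steps, six instructions and one guard; the last, failing guard adds
  1. The effect on array 2 is stated for an arbitrary starting row, so that the induction on the
  number of remaining rows goes through.\<close>

lemma add_multiple_exec:
  assumes "ireg \<sigma> 5 = 1" and "ireg \<sigma> 8 \<le> ireg \<sigma> 0"
  shows "\<exists>\<tau>. ram_exec add_multiple_prog \<sigma> (7 * (ireg \<sigma> 0 - ireg \<sigma> 8) + 1) \<tau> \<and>
    (\<forall>r. r \<noteq> 8 \<longrightarrow> ireg \<tau> r = ireg \<sigma> r) \<and> iarr \<tau> = iarr \<sigma> \<and>
    (\<forall>k. k \<noteq> 2 \<longrightarrow> rarr \<tau> k = rarr \<sigma> k) \<and>
    (\<forall>a b. rarr \<tau> 2 a b = rarr \<sigma> 2 a b +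
       (if b = ireg \<sigma> 7 \<and> ireg \<sigma> 8 \<le> a \<and> a < ireg \<sigma> 0 then rarr \<sigma> 1 a (ireg \<sigma> 6) * rreg \<sigma> 0 else 0))"
  using assms
proof (induction "ireg \<sigma> 0 - ireg \<sigma> 8" arbitrary: \<sigma>)
  case 0
  then have "\<not> guard_holds (ILess 8 0) \<sigma>" by simp
  then have "ram_exec add_multiple_prog \<sigma> 1 \<sigma>"
    unfolding add_multiple_prog_def by (rule ram_exec.intros)
  with 0 show ?case by (intro exI[of _ \<sigma>]) auto
next
  case (Suc m)
  define \<sigma>1 where "\<sigma>1 = set_rreg 1 (rarr \<sigma> 1 (ireg \<sigma> 8) (ireg \<sigma> 6)) \<sigma>"
  define \<sigma>2 where "\<sigma>2 = set_rreg 1 (rreg \<sigma>1 1 * rreg \<sigma>1 0) \<sigma>1"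
  define \<sigma>3 where "\<sigma>3 = set_rreg 2 (rarr \<sigma>2 2 (ireg \<sigma>2 8) (ireg \<sigma>2 7)) \<sigma>2"
  define \<sigma>4 where "\<sigma>4 = set_rreg 2 (rreg \<sigma>3 2 + rreg \<sigma>3 1) \<sigma>3"
  define \<sigma>5 where "\<sigma>5 = set_rcell 2 (ireg \<sigma>4 8) (ireg \<sigma>4 7) (rreg \<sigma>4 2) \<sigma>4"
  define \<sigma>6 where "\<sigma>6 = set_ireg 8 (ireg \<sigma>5 8 + ireg \<sigma>5 5) \<sigma>5"
  note defs = \<sigma>6_def \<sigma>5_def \<sigma>4_def \<sigma>3_def \<sigma>2_def \<sigma>1_def ram_set_defs
  \<comment> \<open>Rule 13 of \<open>ram_exec.intros\<close> is sequencing, and rule 16, used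
    further down, is a successful loop iteration. The intermediate states are unfolded only after
    the splitting, so that each one has the literal form produced by its instruction.\<close>
  have body: "ram_exec (Seq (RLoad 1 1 8 6) (Seq (RMul 1 1 0) (Seq (RLoad 2 2 8 7) (Seq (RAdd 2 2 1)
         (Seq (RStore 2 8 7 2) (IAdd 8 8 5)))))) \<sigma> (1 + (1 + (1 + (1 + (1 + 1))))) \<sigma>6"
    unfolding \<sigma>6_def
    by (intro ram_exec.intros(13), unfold \<sigma>5_def \<sigma>4_def \<sigma>3_def \<sigma>2_def \<sigma>1_def) (rule ram_exec.intros)+
  have ir: "ireg \<sigma>6 = (ireg \<sigma>)(8 := ireg \<sigma> 8 + 1)" using Suc.prems by (simp add: defs)
  have ia: "iarr \<sigma>6 = iarr \<sigma>" by (simp add: defs)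
  have ra: "\<forall>k. k \<noteq> 2 \<longrightarrow> rarr \<sigma>6 k = rarr \<sigma> k" by (simp add: defs)
  have rr: "rreg \<sigma>6 0 = rreg \<sigma> 0" by (simp add: defs)
  have r2: "rarr \<sigma>6 2 a b = rarr \<sigma> 2 a b + (if b = ireg \<sigma> 7 \<and> a = ireg \<sigma> 8 then rarr \<sigma> 1 a (ireg \<sigma> 6) * rreg \<sigma> 0 else 0)"
    for a b by (simp add: defs)
  have pre: "m = ireg \<sigma>6 0 - ireg \<sigma>6 8" "ireg \<sigma>6 5 = 1" "ireg \<sigma>6 8 \<le> ireg \<sigma>6 0"
    using Suc.hyps(2) Suc.prems by (simp_all add: ir)
  obtain \<tau> where \<tau>: "ram_exec add_multiple_prog \<sigma>6 (7 * (ireg \<sigma>6 0 - ireg \<sigma>6 8) + 1) \<tau>"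
    "\<forall>r. r \<noteq> 8 \<longrightarrow> ireg \<tau> r = ireg \<sigma>6 r" "iarr \<tau> = iarr \<sigma>6"
    "\<forall>k. k \<noteq> 2 \<longrightarrow> rarr \<tau> k = rarr \<sigma>6 k"
    "\<forall>a b. rarr \<tau> 2 a b = rarr \<sigma>6 2 a b +
       (if b = ireg \<sigma>6 7 \<and> ireg \<sigma>6 8 \<le> a \<and> a < ireg \<sigma>6 0 then rarr \<sigma>6 1 a (ireg \<sigma>6 6) * rreg \<sigma>6 0 else 0)"
    using Suc.hyps(1)[OF pre] by (elim exE conjE) blast
  have g: "guard_holds (ILess 8 0) \<sigma>" using Suc.hyps(2) by simp
  have "ram_exec add_multiple_prog \<sigma> ((1 + (1 + (1 + (1 + (1 + 1))))) + (7 * (ireg \<sigma>6 0 - ireg \<sigma>6 8) + 1) + 1) \<tau>"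
    using ram_exec.intros(16)[OF g body \<tau>(1)[unfolded add_multiple_prog_def]]
    unfolding add_multiple_prog_def .
  also have "(1 + (1 + (1 + (1 + (1 + 1))))) + (7 * (ireg \<sigma>6 0 - ireg \<sigma>6 8) + 1) + 1
      = 7 * (ireg \<sigma> 0 - ireg \<sigma> 8) + 1"
    using Suc.hyps(2) by (simp add: ir)
  finally show ?case
    using \<tau>(2-) Suc.hyps(2) by (intro exI[of _ \<tau>]) (auto simp: ir ia ra rr r2)
qed

text \<open>One list entry costs \<open>7 * s + 7\<close> steps for \<open>s\<close> rows: three
  loads, one constant, the inner loop with \<open>7 * s + 1\<close>, one increment and the guard.
  The bodies leave arrays 0 and 1 unchanged, so the contributions of the entries simply add
  up.\<close>

lemma sparse_mult_loop_exec:
  assumes "ireg \<sigma> 5 = 1" and "ireg \<sigma> 9 = 0" and "ireg \<sigma> 4 \<le> ireg \<sigma> 3"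
  shows "\<exists>\<tau>. ram_exec (While (ILess 4 3)
         (Seq (ILoad 6 0 4 9) (Seq (ILoad 7 0 4 5) (Seq (RLoad 0 0 4 9) (Seq (IConst 8 0)
           (Seq add_multiple_prog (IAdd 4 4 5))))))) \<sigma>
      ((ireg \<sigma> 3 - ireg \<sigma> 4) * (7 * ireg \<sigma> 0 + 7) + 1) \<tau> \<and>
    (\<forall>a < ireg \<sigma> 0. \<forall>b. rarr \<tau> 2 a b = rarr \<sigma> 2 a b +
       (\<Sum>q\<in>{ireg \<sigma> 4..<ireg \<sigma> 3}. if b = iarr \<sigma> 0 q 1
          then rarr \<sigma> 1 a (iarr \<sigma> 0 q 0) * rarr \<sigma> 0 q 0 else 0))"
  (is "\<exists>\<tau>. ram_exec (While ?g ?B) _ _ _ \<and> _")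
  using assms
proof (induction "ireg \<sigma> 3 - ireg \<sigma> 4" arbitrary: \<sigma>)
  case 0
  then have "\<not> guard_holds (ILess 4 3) \<sigma>" by simp
  then have "ram_exec (While ?g ?B) \<sigma> 1 \<sigma>" by (rule ram_exec.intros)
  with 0 show ?case by (intro exI[of _ \<sigma>]) auto
next
  case (Suc m)
  define \<sigma>1 where "\<sigma>1 = set_ireg 6 (iarr \<sigma> 0 (ireg \<sigma> 4) (ireg \<sigma> 9)) \<sigma>"
  define \<sigma>2 where "\<sigma>2 = set_ireg 7 (iarr \<sigma>1 0 (ireg \<sigma>1 4) (ireg \<sigma>1 5)) \<sigma>1"
  define \<sigma>3 where "\<sigma>3 = set_rreg 0 (rarr \<sigma>2 0 (ireg \<sigma>2 4) (ireg \<sigma>2 9)) \<sigma>2"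
  define \<sigma>4 where "\<sigma>4 = set_ireg 8 0 \<sigma>3"
  note defs = \<sigma>4_def \<sigma>3_def \<sigma>2_def \<sigma>1_def ram_set_defs
  have i4: "ireg \<sigma>4 = (ireg \<sigma>)(6 := iarr \<sigma> 0 (ireg \<sigma> 4) 0, 7 := iarr \<sigma> 0 (ireg \<sigma> 4) 1, 8 := 0)"
    using Suc.prems by (simp add: defs)
  have a4: "iarr \<sigma>4 = iarr \<sigma>" "rarr \<sigma>4 = rarr \<sigma>" "rreg \<sigma>4 0 = rarr \<sigma> 0 (ireg \<sigma> 4) 0"
    using Suc.prems by (simp_all add: defs)
  obtain \<sigma>5 where \<sigma>5: "ram_exec add_multiple_prog \<sigma>4 (7 * (ireg \<sigma>4 0 - ireg \<sigma>4 8) + 1) \<sigma>5"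
    "\<forall>r. r \<noteq> 8 \<longrightarrow> ireg \<sigma>5 r = ireg \<sigma>4 r" "iarr \<sigma>5 = iarr \<sigma>4"
    "\<forall>k. k \<noteq> 2 \<longrightarrow> rarr \<sigma>5 k = rarr \<sigma>4 k"
    "\<forall>a b. rarr \<sigma>5 2 a b = rarr \<sigma>4 2 a b +
       (if b = ireg \<sigma>4 7 \<and> ireg \<sigma>4 8 \<le> a \<and> a < ireg \<sigma>4 0 then rarr \<sigma>4 1 a (ireg \<sigma>4 6) * rreg \<sigma>4 0 else 0)"
    using add_multiple_exec[of \<sigma>4] Suc.prems by (auto simp: i4)
  define \<sigma>6 where "\<sigma>6 = set_ireg 4 (ireg \<sigma>5 4 + ireg \<sigma>5 5) \<sigma>5"
  have body: "ram_exec ?B \<sigma> (1 + (1 + (1 + (1 + ((7 * (ireg \<sigma>4 0 - ireg \<sigma>4 8) + 1) + 1))))) \<sigma>6"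
    unfolding \<sigma>6_def
    by (intro ram_exec.intros(13), unfold \<sigma>4_def \<sigma>3_def \<sigma>2_def \<sigma>1_def,
        (rule ram_exec.intros)+, rule \<sigma>5(1)[unfolded \<sigma>4_def \<sigma>3_def \<sigma>2_def \<sigma>1_def], rule ram_exec.intros)
  have i6: "ireg \<sigma>6 0 = ireg \<sigma> 0" "ireg \<sigma>6 3 = ireg \<sigma> 3" "ireg \<sigma>6 4 = ireg \<sigma> 4 + 1" "ireg \<sigma>6 5 = 1" "ireg \<sigma>6 9 = 0"
    using Suc.prems \<sigma>5(2) by (simp_all add: \<sigma>6_def ram_set_defs i4)
  have a6: "iarr \<sigma>6 = iarr \<sigma>" "rarr \<sigma>6 0 = rarr \<sigma> 0" "rarr \<sigma>6 1 = rarr \<sigma> 1"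
    using \<sigma>5 by (simp_all add: \<sigma>6_def ram_set_defs a4)
  have r6: "rarr \<sigma>6 2 a b = rarr \<sigma> 2 a b +
       (if b = iarr \<sigma> 0 (ireg \<sigma> 4) 1 then rarr \<sigma> 1 a (iarr \<sigma> 0 (ireg \<sigma> 4) 0) * rarr \<sigma> 0 (ireg \<sigma> 4) 0 else 0)"
    if "a < ireg \<sigma> 0" for a b
    using \<sigma>5(5) that by (simp add: \<sigma>6_def ram_set_defs a4 i4)
  have pre: "m = ireg \<sigma>6 3 - ireg \<sigma>6 4" "ireg \<sigma>6 5 = 1" "ireg \<sigma>6 9 = 0" "ireg \<sigma>6 4 \<le> ireg \<sigma>6 3"
    using Suc.hyps(2) by (simp_all add: i6)
  obtain \<tau> where \<tau>: "ram_exec (While ?g ?B) \<sigma>6 ((ireg \<sigma>6 3 - ireg \<sigma>6 4) * (7 * ireg \<sigma>6 0 + 7) + 1) \<tau>"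
    "\<forall>a < ireg \<sigma>6 0. \<forall>b. rarr \<tau> 2 a b = rarr \<sigma>6 2 a b +
       (\<Sum>q\<in>{ireg \<sigma>6 4..<ireg \<sigma>6 3}. if b = iarr \<sigma>6 0 q 1
          then rarr \<sigma>6 1 a (iarr \<sigma>6 0 q 0) * rarr \<sigma>6 0 q 0 else 0)"
    using Suc.hyps(1)[OF pre] by (elim exE conjE) blast
  have g: "guard_holds ?g \<sigma>" using Suc.hyps(2) by simp
  have "ram_exec (While ?g ?B) \<sigma> ((1 + (1 + (1 + (1 + ((7 * (ireg \<sigma>4 0 - ireg \<sigma>4 8) + 1) + 1)))))
      + ((ireg \<sigma>6 3 - ireg \<sigma>6 4) * (7 * ireg \<sigma>6 0 + 7) + 1) + 1) \<tau>"
    by (rule ram_exec.intros(16)[OF g body \<tau>(1)])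
  also have "(1 + (1 + (1 + (1 + ((7 * (ireg \<sigma>4 0 - ireg \<sigma>4 8) + 1) + 1)))))
      + ((ireg \<sigma>6 3 - ireg \<sigma>6 4) * (7 * ireg \<sigma>6 0 + 7) + 1) + 1 = (ireg \<sigma> 3 - ireg \<sigma> 4) * (7 * ireg \<sigma> 0 + 7) + 1"
  proof -
    have "ireg \<sigma> 3 - ireg \<sigma> 4 = Suc (ireg \<sigma>6 3 - ireg \<sigma>6 4)"
      using Suc.hyps(2) by (simp add: i6)
    then show ?thesis by (simp only: i6(1)) (simp add: i4)
  qed
  finally show ?case
    using \<tau>(2)[unfolded i6 a6] Suc.hyps(2)
    by (intro exI[of _ \<tau>]) (auto simp: r6 sum.atLeast_Suc_lessThan cong: if_cong)
qed

lemma multiplies_within_mono: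
  "multiplies_within P S A T \<Longrightarrow> T \<le> T' \<Longrightarrow> multiplies_within P S A T'"
  unfolding multiplies_within_def by (meson order_trans)

text \<open>An entry at \<open>(k, j)\<close> adds \<open>S $$ (i, k) * A $$ (k, j)\<close> to cell
  \<open>(i, j)\<close> of an array that starts at zero. As \<open>L\<close> is distinct, summing
  over the list is summing over the nonzero positions, and the positions missing in column
  \<open>j\<close> contribute 0 to the scalar product. The 2 counts the initial constant and the
  last guard.\<close>

lemma sparse_mult_correct:
  assumes S: "S \<in> carrier_mat s n" and A: "A \<in> carrier_mat n d"
  shows "multiplies_within sparse_mult_prog S A (real (nnz A) * (7 * real s + 7) + 2)"
  unfolding multiplies_within_def
proof (intro allI impI, elim conjE)
  fix L :: "(nat \<times> nat) list" assume L: "distinct L" "set L = nonzero_entries A"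
  define \<sigma> where "\<sigma> = set_ireg 5 1 (mult_input S A L)"
  obtain \<tau> where \<tau>: "ram_exec (While (ILess 4 3)
         (Seq (ILoad 6 0 4 9) (Seq (ILoad 7 0 4 5) (Seq (RLoad 0 0 4 9) (Seq (IConst 8 0)
           (Seq add_multiple_prog (IAdd 4 4 5))))))) \<sigma>
      ((ireg \<sigma> 3 - ireg \<sigma> 4) * (7 * ireg \<sigma> 0 + 7) + 1) \<tau>"
    "\<forall>a < ireg \<sigma> 0. \<forall>b. rarr \<tau> 2 a b = rarr \<sigma> 2 a b +
       (\<Sum>q\<in>{ireg \<sigma> 4..<ireg \<sigma> 3}. if b = iarr \<sigma> 0 q 1
          then rarr \<sigma> 1 a (iarr \<sigma> 0 q 0) * rarr \<sigma> 0 q 0 else 0)"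
    using sparse_mult_loop_exec[of \<sigma>] by (auto simp: \<sigma>_def mult_input_def set_ireg_def)
  have ex: "ram_exec sparse_mult_prog (mult_input S A L)
      (1 + ((ireg \<sigma> 3 - ireg \<sigma> 4) * (7 * ireg \<sigma> 0 + 7) + 1)) \<tau>"
    unfolding sparse_mult_prog_def
    by (rule ram_exec.intros(13)[OF ram_exec.intros(1) \<tau>(1)[unfolded \<sigma>_def], folded \<sigma>_def])
  have len: "length L = nnz A" using L by (metis distinct_card nnz_def)
  have dims: "dim_row S = s" "dim_col S = n" "dim_row A = n" "dim_col A = d" using S A by auto
  have time: "real (1 + ((ireg \<sigma> 3 - ireg \<sigma> 4) * (7 * ireg \<sigma> 0 + 7) + 1)) \<le> real (nnz A) * (7 * real s + 7) + 2"
    by (simp add: \<sigma>_def mult_input_def set_ireg_def len dims algebra_simps)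
  have "rarr \<tau> 2 i j = (S * A) $$ (i, j)" if i: "i < dim_row S" and j: "j < dim_col A" for i j
  proof -
    have mem: "fst (L ! q) < n \<and> snd (L ! q) < d" if "q < length L" for q
      using L that nth_mem[OF that] dims by (auto simp: nonzero_entries_def split: prod.splits)
    have "rarr \<tau> 2 i j = (\<Sum>q\<in>{0..<length L}. if j = snd (L ! q)
          then S $$ (i, fst (L ! q)) * A $$ (L ! q) else 0)"
      using \<tau>(2) i mem
      by (auto simp: \<sigma>_def mult_input_def set_ireg_def dims intro!: sum.cong)
    also have "\<dots> = (\<Sum>e\<in>set L. if j = snd e then S $$ (i, fst e) * A $$ e else 0)"
      using bij_betw_nth[OF L(1), of "{0..<length L}" "set L"]
      by (intro sum.reindex_bij_betw) (auto simp: atLeast0LessThan)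
    also have "\<dots> = (\<Sum>e\<in>nonzero_entries A \<inter> {e. j = snd e}. S $$ (i, fst e) * A $$ e)"
      unfolding L(2)[symmetric] by (subst sum.inter_restrict) auto
    also have "\<dots> = (\<Sum>e\<in>(\<lambda>k. (k, j)) ` {..<n}. S $$ (i, fst e) * A $$ e)"
      using j by (intro sum.mono_neutral_left) (auto simp: nonzero_entries_def dims)
    also have "\<dots> = (\<Sum>k<n. S $$ (i, k) * A $$ (k, j))"
      by (subst sum.reindex) (auto simp: inj_on_def)
    also have "\<dots> = (S * A) $$ (i, j)"
      using i j by (simp add: scalar_prod_def dims atLeast0LessThan)
    finally show ?thesis .
  qed
  with ex time show "\<exists>t \<tau>. ram_exec sparse_mult_prog (mult_input S A L) t \<tau> \<and>
      real t \<le> real (nnz A) * (7 * real s + 7) + 2 \<and>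
      (\<forall>i<dim_row S. \<forall>j<dim_col A. rarr \<tau> 2 i j = (S * A) $$ (i, j))"
    by blast
qed

subsection \<open>A near-maximal position of Lewis type\<close>

text \<open>The matrix determinant lemma. The bordered matrix with diagonal blocks \<open>1\<close>
  and \<open>1\<^sub>m d\<close>, row \<open>- x\<close> and column \<open>x\<close> factors into
  block triangular matrices in two ways, one for each Schur complement; comparing determinants gives
  the claim without division.\<close>

lemma det_one_plus_rank_one:
  fixes x :: "'a :: idom vec"
  assumes x: "x \<in> carrier_vec d"
  shows "det (1\<^sub>m d + mat d d (\<lambda>(i, j). vec_index x i * vec_index x j))
    = 1 + (\<Sum>j<d. (vec_index x j)\<^sup>2)"
proof -
  let ?R = "mat d d (\<lambda>(i, j). vec_index x i * vec_index x j)"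
  let ?c = "mat d 1 (\<lambda>(i, j). vec_index x i)"
  let ?r = "mat 1 d (\<lambda>(i, j). - vec_index x j)"
  let ?s = "mat 1 1 (\<lambda>_. 1 + (\<Sum>j<d. (vec_index x j)\<^sup>2))"
  have 1: "four_block_mat (1\<^sub>m 1) (0\<^sub>m 1 d) ?c (1\<^sub>m d) * four_block_mat (1\<^sub>m 1) ?r (0\<^sub>m d 1) (1\<^sub>m d + ?R)
      = four_block_mat (1\<^sub>m 1) ?r ?c (1\<^sub>m d)"
  proof (subst mult_four_block_mat[where ?n1.0 = 1 and ?n2.0 = d and ?nr1.0 = 1 and ?nr2.0 = d
        and ?nc1.0 = 1 and ?nc2.0 = d], simp_all)
    have "?c * ?r = - ?R"
      by (rule eq_matI) (auto simp: scalar_prod_def)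
    then have "?c * ?r + (1\<^sub>m d + ?R) = 1\<^sub>m d"
      by (intro eq_matI) auto
    then show "four_block_mat (1\<^sub>m (Suc 0)) (mat (Suc 0) d (\<lambda>(i, j). - vec_index x j))
        (mat d (Suc 0) (\<lambda>(i, j). vec_index x i))
        (mat d (Suc 0) (\<lambda>(i, j). vec_index x i) * mat (Suc 0) d (\<lambda>(i, j). - vec_index x j) + (1\<^sub>m d + ?R))
      = four_block_mat (1\<^sub>m (Suc 0)) (mat (Suc 0) d (\<lambda>(i, j). - vec_index x j))
        (mat d (Suc 0) (\<lambda>(i, j). vec_index x i)) (1\<^sub>m d)"
      by simp
  qed
  have 2: "four_block_mat ?s ?r (0\<^sub>m d 1) (1\<^sub>m d) * four_block_mat (1\<^sub>m 1) (0\<^sub>m 1 d) ?c (1\<^sub>m d)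
      = four_block_mat (1\<^sub>m 1) ?r ?c (1\<^sub>m d)"
  proof (subst mult_four_block_mat[where ?n1.0 = 1 and ?n2.0 = d and ?nr1.0 = 1 and ?nr2.0 = d
        and ?nc1.0 = 1 and ?nc2.0 = d], simp_all)
    have "?s + ?r * ?c = 1\<^sub>m 1"
      by (rule eq_matI) (auto simp: scalar_prod_def sum_negf power2_eq_square atLeast0LessThan)
    then show "four_block_mat (mat (Suc 0) (Suc 0) (\<lambda>_. 1 + (\<Sum>j<d. (vec_index x j)\<^sup>2)) +
        mat (Suc 0) d (\<lambda>(i, j). - vec_index x j) * mat d (Suc 0) (\<lambda>(i, j). vec_index x i))
        (mat (Suc 0) d (\<lambda>(i, j). - vec_index x j)) (mat d (Suc 0) (\<lambda>(i, j). vec_index x i)) (1\<^sub>m d)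
      = four_block_mat (1\<^sub>m (Suc 0)) (mat (Suc 0) d (\<lambda>(i, j). - vec_index x j))
        (mat d (Suc 0) (\<lambda>(i, j). vec_index x i)) (1\<^sub>m d)"
      by simp
  qed
  have d1: "det (four_block_mat (1\<^sub>m 1) (0\<^sub>m 1 d) ?c (1\<^sub>m d)) = (1 :: 'a)"
    by (subst det_four_block_mat_upper_right_zero[where n = 1 and m = d]) auto
  have d2: "det (four_block_mat (1\<^sub>m 1) ?r (0\<^sub>m d 1) (1\<^sub>m d + ?R)) = det (1\<^sub>m d + ?R)"
    by (subst det_four_block_mat_lower_left_zero[where n = 1 and m = d]) auto
  have d3: "det (four_block_mat ?s ?r (0\<^sub>m d 1) (1\<^sub>m d)) = 1 + (\<Sum>j<d. (vec_index x j)\<^sup>2)"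
    by (subst det_four_block_mat_lower_left_zero[where n = 1 and m = d]) (auto simp: det_single)
  have c: "four_block_mat (1\<^sub>m 1) (0\<^sub>m 1 d) ?c (1\<^sub>m d) \<in> carrier_mat (1 + d) (1 + d)"
    "four_block_mat (1\<^sub>m 1) ?r (0\<^sub>m d 1) (1\<^sub>m d + ?R) \<in> carrier_mat (1 + d) (1 + d)"
    "four_block_mat ?s ?r (0\<^sub>m d 1) (1\<^sub>m d) \<in> carrier_mat (1 + d) (1 + d)"
    by (auto intro!: four_block_carrier_mat)
  show ?thesis
    using arg_cong[OF 1, of det] arg_cong[OF 2, of det]
    unfolding det_mult[OF c(1,2)] det_mult[OF c(3,1)] d1 d2 d3 by simp
qed

text \<open>The Leibniz expansion term by term. The bound is crude, but it serves only to show that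
  a supremum of determinants is finite.\<close>

lemma abs_det_le:
  fixes C :: "real mat"
  assumes C: "C \<in> carrier_mat d d" and M: "\<And>i j. i < d \<Longrightarrow> j < d \<Longrightarrow> \<bar>C $$ (i, j)\<bar> \<le> M"
  shows "\<bar>det C\<bar> \<le> fact d * M ^ d"
proof -
  have "\<bar>det C\<bar> \<le> (\<Sum>q | q permutes {0..<d}. \<bar>signof q * (\<Prod>i = 0..<d. C $$ (i, q i))\<bar>)"
    unfolding det_def'[OF C] by (rule sum_abs)
  also have "\<dots> \<le> (\<Sum>q | q permutes {0..<d}. M ^ d)"
  proof (rule sum_mono)
    fix q assume "q \<in> {q. q permutes {0..<d}}"
    then have "q i < d" if "i < d" for i using that permutes_in_image[of q "{0..<d}" i] by auto
    then have "(\<Prod>i = 0..<d. \<bar>C $$ (i, q i)\<bar>) \<le> (\<Prod>i = 0..<d. M)"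
      by (intro prod_mono) (auto intro: M)
    then show "\<bar>signof q * (\<Prod>i = 0..<d. C $$ (i, q i))\<bar> \<le> M ^ d"
      by (simp add: abs_mult abs_prod sign_def)
  qed
  also have "\<dots> = fact d * M ^ d"
    using card_permutations[of "{0..<d}" d] by simp
  finally show ?thesis .
qed

text \<open>A kernel vector \<open>v\<close> of the Gram matrix satisfies \<open>A v = 0\<close>,
  since the squared length of \<open>A v\<close> is the scalar product of \<open>v\<close> with the
  Gram image of \<open>v\<close>. The rank refers to the set of columns, so repeated columns have to
  be excluded before \<open>A v = 0\<close> becomes a linear dependence.\<close>

lemma full_rank_det_gram:
  fixes A :: "real mat"
  assumes A: "A \<in> carrier_mat n d" and rank: "vec_space.rank n A = d"
  shows "det (transpose_mat A * A) \<noteq> 0"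
proof
  interpret vec_space "TYPE(real)" n .
  have dist: "distinct (cols A)"
  proof (rule ccontr)
    assume "\<not> distinct (cols A)"
    then have less: "card (set (cols A)) < d"
      using A card_length[of "cols A"] card_distinct[of "cols A"] by fastforce
    obtain S where S: "maximal S (\<lambda>T. T \<subseteq> set (cols A) \<and> lin_indpt T)" "finite S"
      using maximal_exists_superset[of "set (cols A)" "\<lambda>T. T \<subseteq> set (cols A) \<and> lin_indpt T" "{}"]
      by (auto simp: lin_dep_def)
    then have "card S \<le> card (set (cols A))"
      by (intro card_mono) (auto simp: maximal_def)
    then show False using rank_card_indpt[OF A S(1)] rank less by simp
  qed
  assume "det (transpose_mat A * A) = 0"
  then obtain v where v: "v \<in> carrier_vec d" "v \<noteq> 0\<^sub>v d" "(transpose_mat A * A) *\<^sub>v v = 0\<^sub>v d"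
    using det_0_iff_vec_prod_zero_field[of "transpose_mat A * A" d] A by auto
  have "scalar_prod (A *\<^sub>v v) (A *\<^sub>v v) = scalar_prod v (transpose_mat A *\<^sub>v (A *\<^sub>v v))"
    using A v by (metis assoc_scalar_prod comm_scalar_prod mult_mat_vec_carrier transpose_carrier_mat
      transpose_vec_mult_scalar)
  also have "\<dots> = 0"
    using A v by simp
  finally have "A *\<^sub>v v = 0\<^sub>v n"
    using A v by (auto simp: scalar_prod_def sum_nonneg_eq_0_iff intro!: eq_vecI)
  then have "lin_dep (set (cols A))"
    by (intro lin_depI[OF A v(1,2) _ dist])
  then show False
    using full_rank_lin_indpt[OF A rank dist] by simp
qed

lemma power2_powr_half: "(x\<^sup>2) powr (q / 2) = \<bar>x\<bar> powr q" for x q :: real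
proof (cases "x = 0")
  case False
  then have "x\<^sup>2 = \<bar>x\<bar> powr 2" by simp
  then show ?thesis by (simp only: powr_powr) simp
qed simp

text \<open>A concave power lies below its tangent at \<open>a\<close>. The proof is Young's
  inequality with weights \<open>q\<close> and \<open>1 - q\<close> for the numbers
  \<open>(a + b) / a\<close> and \<open>1\<close>.\<close>

lemma powr_add_le_tangent:
  fixes a b q :: real
  assumes "0 < a" "0 \<le> b" "0 \<le> q" "q \<le> 1"
  shows "(a + b) powr q \<le> a powr q + q * a powr (q - 1) * b"
proof -
  have "((a + b) / a) powr q * 1 powr (1 - q) \<le> q * ((a + b) / a) + (1 - q) * 1"
    using assms by (intro Youngs_inequality_0) auto
  also have "\<dots> = 1 + q * (b / a)" using assms by (simp add: field_simps)
  finally have "((a + b) / a) powr q \<le> 1 + q * (b / a)" by simp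
  then have "a powr q * ((a + b) / a) powr q \<le> a powr q * (1 + q * (b / a))"
    by (intro mult_left_mono) auto
  also have "a powr q * ((a + b) / a) powr q = (a + b) powr q"
    using assms by (simp flip: powr_mult)
  also have "a powr q * (1 + q * (b / a)) = a powr q + q * a powr (q - 1) * b"
    using assms by (simp add: powr_diff field_simps)
  finally show ?thesis .
qed

section \<open>Row norms, row forms and stretching along a direction\<close>

definition row_sq :: "real mat \<Rightarrow> nat \<Rightarrow> real" where
  "row_sq U i = (\<Sum>j<dim_col U. (U $$ (i, j))\<^sup>2)"

text \<open>Coordinate \<open>i\<close> of the product of \<open>U\<close> with \<open>y\<close>.
  Using plain functions for \<open>y\<close> frees sums, multiples and roundings of vectors from
  dimension conditions.\<close>

definition row_form :: "real mat \<Rightarrow> nat \<Rightarrow> (nat \<Rightarrow> real) \<Rightarrow> real" where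
  "row_form U i y = (\<Sum>j<dim_col U. U $$ (i, j) * y j)"

lemma row_sq_nonneg [simp]: "0 \<le> row_sq U i"
  by (simp add: row_sq_def sum_nonneg)

lemma row_form_sq_le: "(row_form U i y)\<^sup>2 \<le> row_sq U i * (\<Sum>j<dim_col U. (y j)\<^sup>2)"
  unfolding row_form_def row_sq_def by (rule Cauchy_Schwarz_ineq_sum)

lemma row_sq_smult:
  "i < dim_row U \<Longrightarrow> row_sq (t \<cdot>\<^sub>m U) i = t\<^sup>2 * row_sq U i"
  by (simp add: row_sq_def power_mult_distrib sum_distrib_left)

lemma abs_entry_le_row_sq:
  "j < dim_col U \<Longrightarrow> \<bar>U $$ (i, j)\<bar> \<le> sqrt (row_sq U i)"
  unfolding row_sq_def
  by (rule real_le_rsqrt) (auto intro!: member_le_sum[where f = "\<lambda>j. (U $$ (i, j))\<^sup>2"])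

text \<open>The factor doubles the component along the unit vector and fixes its orthogonal
  complement, so the square of that component grows from \<open>c\<^sup>2\<close> to
  \<open>4 * c\<^sup>2\<close>.\<close>

lemma row_sq_mult_one_plus_rank_one:
  assumes U: "U \<in> carrier_mat n d" and x: "x \<in> carrier_vec d" and i: "i < n"
    and unit: "(\<Sum>j<d. (vec_index x j)\<^sup>2) = 1"
  shows "row_sq (U * (1\<^sub>m d + mat d d (\<lambda>(i, j). vec_index x i * vec_index x j))) i
    = row_sq U i + 3 * (row_form U i (vec_index x))\<^sup>2"
proof -
  let ?c = "row_form U i (vec_index x)"
  have "(U * (1\<^sub>m d + mat d d (\<lambda>(i, j). vec_index x i * vec_index x j))) $$ (i, j)
      = U $$ (i, j) + ?c * vec_index x j" if "j < d" for j
  proof -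
    have "(U * (1\<^sub>m d + mat d d (\<lambda>(i, j). vec_index x i * vec_index x j))) $$ (i, j)
      = (\<Sum>k<d. U $$ (i, k) * ((if k = j then 1 else 0) + vec_index x k * vec_index x j))"
      using U i that by (auto simp: scalar_prod_def atLeast0LessThan intro!: sum.cong)
    also have "\<dots> = (\<Sum>k<d. (if k = j then U $$ (i, k) else 0) + U $$ (i, k) * vec_index x k * vec_index x j)"
      by (intro sum.cong) (auto simp: algebra_simps)
    also have "\<dots> = (\<Sum>k<d. (if k = j then U $$ (i, k) else 0)) + ?c * vec_index x j"
      using U by (simp add: row_form_def sum.distrib sum_distrib_right)
    also have "\<dots> = U $$ (i, j) + ?c * vec_index x j" using that by simp
    finally show ?thesis .
  qed
  then have "row_sq (U * (1\<^sub>m d + mat d d (\<lambda>(i, j). vec_index x i * vec_index x j))) i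
      = (\<Sum>j<d. (U $$ (i, j) + ?c * vec_index x j)\<^sup>2)"
    by (simp add: row_sq_def)
  also have "\<dots> = (\<Sum>j<d. (U $$ (i, j))\<^sup>2 + 2 * ?c * (U $$ (i, j) * vec_index x j) + ?c\<^sup>2 * (vec_index x j)\<^sup>2)"
    by (intro sum.cong) (auto simp: power2_sum power_mult_distrib algebra_simps)
  also have "\<dots> = row_sq U i + 2 * ?c * ?c + ?c\<^sup>2 * 1"
    using U unfolding sum.distrib sum_distrib_left[symmetric] unit by (simp add: row_sq_def row_form_def)
  finally show ?thesis by (simp add: power2_eq_square)
qed

text \<open>The energy bounds every entry of \<open>A * B\<close>, hence every entry of
  \<open>transpose_mat A * (A * B)\<close>. Its determinant is the Gram determinant times
  \<open>det B\<close>, and the former is a nonzero constant.\<close>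

lemma det_bounded_by_row_sq:
  assumes A: "A \<in> carrier_mat n d" and gram: "det (transpose_mat A * A) \<noteq> 0" and p: "0 < p"
  shows "\<exists>M. \<forall>B\<in>carrier_mat d d. (\<Sum>i<n. row_sq (A * B) i powr (p / 2)) \<le> real d \<longrightarrow> \<bar>det B\<bar> \<le> M"
proof -
  define M where "M = (\<Sum>i<d. \<Sum>k<n. \<bar>A $$ (k, i)\<bar> * real d powr (1 / p))"
  have "\<bar>det B\<bar> \<le> fact d * M ^ d / \<bar>det (transpose_mat A * A)\<bar>"
    if B: "B \<in> carrier_mat d d" and le: "(\<Sum>i<n. row_sq (A * B) i powr (p / 2)) \<le> real d" for B
  proof -
    have AB: "A * B \<in> carrier_mat n d" using A B by simp
    have entry: "\<bar>(A * B) $$ (k, j)\<bar> \<le> real d powr (1 / p)" if "k < n" "j < d" for k j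
    proof -
      have "row_sq (A * B) k powr (p / 2) \<le> (\<Sum>i<n. row_sq (A * B) i powr (p / 2))"
        using that by (intro member_le_sum) auto
      then have "row_sq (A * B) k powr (p / 2) \<le> real d" using le by linarith
      then have "(row_sq (A * B) k powr (p / 2)) powr (1 / p) \<le> real d powr (1 / p)"
        using p by (intro powr_mono2) auto
      then have "sqrt (row_sq (A * B) k) \<le> real d powr (1 / p)"
        using p by (simp add: powr_powr powr_half_sqrt)
      then show ?thesis using abs_entry_le_row_sq[of j "A * B" k] B that by simp
    qed
    have "\<bar>(transpose_mat A * (A * B)) $$ (i, j)\<bar> \<le> M" if "i < d" "j < d" for i j
    proof -
      have "(transpose_mat A * (A * B)) $$ (i, j) = (\<Sum>k<n. A $$ (k, i) * (A * B) $$ (k, j))"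
        using A B that by (simp add: scalar_prod_def atLeast0LessThan)
      also have "\<bar>\<dots>\<bar> \<le> (\<Sum>k<n. \<bar>A $$ (k, i)\<bar> * real d powr (1 / p))"
        using entry that
        by (intro order_trans[OF sum_abs] sum_mono) (auto simp: abs_mult intro!: mult_left_mono)
      also have "\<dots> \<le> M" unfolding M_def
        using that by (intro member_le_sum[where f = "\<lambda>i. \<Sum>k<n. \<bar>A $$ (k, i)\<bar> * real d powr (1 / p)"])
          (auto intro!: sum_nonneg)
      finally show ?thesis .
    qed
    then have "\<bar>det (transpose_mat A * (A * B))\<bar> \<le> fact d * M ^ d"
      using A AB by (intro abs_det_le) auto
    also have "transpose_mat A * (A * B) = (transpose_mat A * A) * B"
      using A B by (intro assoc_mult_mat[symmetric]) auto
    also have "\<bar>det \<dots>\<bar> = \<bar>det (transpose_mat A * A)\<bar> * \<bar>det B\<bar>"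
      using A B by (subst det_mult[of _ d]) (auto simp: abs_mult)
    finally show ?thesis using gram by (simp add: field_simps)
  qed
  then show ?thesis by blast
qed

lemma row_energy_scale:
  assumes "dim_row U = n" "0 < t"
  shows "(\<Sum>i<n. row_sq (t \<cdot>\<^sub>m U) i powr (p / 2)) = t powr p * (\<Sum>i<n. row_sq U i powr (p / 2))"
proof -
  have "t\<^sup>2 powr (p / 2) = t powr p"
    using assms by (simp add: powr_powr flip: powr_numeral)
  then show ?thesis
    using assms by (simp add: row_sq_smult powr_mult sum_distrib_left)
qed

text \<open>A position of Lewis type is a maximiser of the determinant under a bound on the sum of the
  \<open>p\<close>-th powers of the row norms. A near-maximiser is enough here: stretching it by the factor \<open>2\<close>
  along a unit vector \<open>x\<close> doubles the determinant, so the energy of the rows must grow noticeably.\<close>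

lemma near_maximal_position:
  assumes A: "A \<in> carrier_mat n d" and gram: "det (transpose_mat A * A) \<noteq> 0"
    and p: "0 < p" "p \<le> 2" and d: "0 < d"
  shows "\<exists>B\<in>carrier_mat d d. det B \<noteq> 0 \<and> (\<Sum>i<n. row_sq (A * B) i powr (p / 2)) \<le> real d \<and>
    (\<forall>x\<in>carrier_vec d. (\<Sum>j<d. (vec_index x j)\<^sup>2) = 1 \<longrightarrow>
      1 / 6 \<le> (\<Sum>i<n. row_sq (A * B) i powr (p / 2 - 1) * (row_form (A * B) i (vec_index x))\<^sup>2))"
proof -
  define E where "E B = (\<Sum>i<n. row_sq (A * B) i powr (p / 2))" for B
  define K where "K = {B \<in> carrier_mat d d. E B \<le> real d}"
  define m where "m = (SUP B\<in>K. \<bar>det B\<bar>)"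
  obtain M where M: "\<And>B. B \<in> K \<Longrightarrow> \<bar>det B\<bar> \<le> M"
    using det_bounded_by_row_sq[OF A gram p(1)] by (auto simp: K_def E_def)
  have bdd: "bdd_above ((\<lambda>B. \<bar>det B\<bar>) ` K)" using M by (auto intro!: bdd_aboveI2)
  have E_nonneg: "0 \<le> E B" for B by (simp add: E_def sum_nonneg)
  have E_scale: "E (t \<cdot>\<^sub>m B) = t powr p * E B" if "B \<in> carrier_mat d d" "0 < t" for t B
    using that A mult_smult_distrib[OF A that(1)] by (simp add: E_def row_energy_scale)
  \<comment> \<open>The energy is homogeneous of degree \<open>p\<close>, so this factor brings a
    matrix that exceeds the budget by \<open>e\<close> back into \<open>K\<close>.\<close>
  have rescale: "(real d / (real d + e)) powr (1 / p) \<cdot>\<^sub>m B \<in> K"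
    if B: "B \<in> carrier_mat d d" and e: "E B \<le> real d + e" "0 \<le> e" for B e
  proof -
    have "E ((real d / (real d + e)) powr (1 / p) \<cdot>\<^sub>m B) = real d / (real d + e) * E B"
      using B e d p by (subst E_scale) (auto simp: powr_powr)
    also have "\<dots> \<le> real d / (real d + e) * (real d + e)"
      using e by (intro mult_left_mono) auto
    also have "\<dots> = real d" using d e by simp
    finally show ?thesis using B by (simp add: K_def)
  qed
  have "0 < m"
  proof -
    let ?t = "(real d / (real d + E (1\<^sub>m d))) powr (1 / p)"
    have "0 < \<bar>det (?t \<cdot>\<^sub>m 1\<^sub>m d :: real mat)\<bar>"
      using d E_nonneg[of "1\<^sub>m d"] by (auto simp: add_pos_nonneg)
    also have "\<dots> \<le> m" unfolding m_def
      using E_nonneg[of "1\<^sub>m d"] by (intro cSUP_upper bdd rescale) auto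
    finally show ?thesis .
  qed
  \<comment> \<open>Any factor strictly between 1 and 2 would serve. As the stretch doubles the
    determinant, \<open>3 / 2\<close> leads to \<open>t ^ d \<le> 3 / 4\<close>, and with
    \<open>1 - 3 / 2 * ?Q \<le> t ^ d\<close> this gives the constant \<open>1 / 6\<close>.\<close>
  then have "m / (3 / 2) < (SUP B\<in>K. \<bar>det B\<bar>)" by (simp add: m_def)
  moreover have "K \<noteq> {}" using rescale[of "1\<^sub>m d" "E (1\<^sub>m d)"] E_nonneg by auto
  ultimately obtain B where B: "B \<in> K" "m / (3 / 2) < \<bar>det B\<bar>"
    using less_cSUP_iff[OF _ bdd, of "m / (3 / 2)"] by blast
  have Bc: "B \<in> carrier_mat d d" and BE: "E B \<le> real d" using B by (auto simp: K_def)
  have AB: "A * B \<in> carrier_mat n d" using A Bc by simp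
  have detB: "det B \<noteq> 0" using B(2) \<open>0 < m\<close> by auto
  have "1 / 6 \<le> (\<Sum>i<n. row_sq (A * B) i powr (p / 2 - 1) * (row_form (A * B) i (vec_index x))\<^sup>2)"
    (is "_ \<le> ?Q")
    if x: "x \<in> carrier_vec d" and unit: "(\<Sum>j<d. (vec_index x j)\<^sup>2) = 1" for x
  proof -
    let ?R = "1\<^sub>m d + mat d d (\<lambda>(i, j). vec_index x i * vec_index x j)"
    have R: "?R \<in> carrier_mat d d" by simp
    have Q: "0 \<le> ?Q" by (auto intro!: sum_nonneg)
    have "E (B * ?R) = (\<Sum>i<n. (row_sq (A * B) i + 3 * (row_form (A * B) i (vec_index x))\<^sup>2) powr (p / 2))"
      unfolding E_def assoc_mult_mat[OF A Bc R, symmetric]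
      by (intro sum.cong refl) (simp add: row_sq_mult_one_plus_rank_one[OF AB x _ unit])
    also have "\<dots> \<le> (\<Sum>i<n. row_sq (A * B) i powr (p / 2)
        + (p / 2) * row_sq (A * B) i powr (p / 2 - 1) * (3 * (row_form (A * B) i (vec_index x))\<^sup>2))"
    proof (rule sum_mono)
      fix i
      show "(row_sq (A * B) i + 3 * (row_form (A * B) i (vec_index x))\<^sup>2) powr (p / 2)
        \<le> row_sq (A * B) i powr (p / 2)
        + (p / 2) * row_sq (A * B) i powr (p / 2 - 1) * (3 * (row_form (A * B) i (vec_index x))\<^sup>2)"
      proof (cases "row_sq (A * B) i = 0")
        \<comment> \<open>The exponent \<open>p / 2 - 1\<close> may be negative here, but
          \<open>0 powr q = 0\<close> for every \<open>q\<close>, so a zero row contributes 0 on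
          both sides.\<close>
        case True
        then have "row_form (A * B) i (vec_index x) = 0"
          using row_form_sq_le[of "A * B" i "vec_index x"] by simp
        with True show ?thesis by simp
      next
        case False
        then have "0 < row_sq (A * B) i" by (simp add: less_le)
        then show ?thesis using p by (intro powr_add_le_tangent) auto
      qed
    qed
    also have "\<dots> = E B + 3 * p / 2 * ?Q"
      by (simp add: E_def sum.distrib sum_distrib_left algebra_simps)
    finally have E': "E (B * ?R) \<le> real d + 3 * p / 2 * ?Q" using BE by linarith
    define t where "t = (real d / (real d + 3 * p / 2 * ?Q)) powr (1 / p)"
    have "0 < real d + 3 * p / 2 * ?Q" using d p Q by (intro add_pos_nonneg) auto
    then have t_eq: "t = (1 + 3 * p / 2 * ?Q / real d) powr (- (1 / p))"
      using d by (simp add: t_def powr_minus powr_divide field_simps flip: add_divide_distrib)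
    have one: "1 \<le> 1 + 3 * p / 2 * ?Q / real d" using d p Q by simp
    \<comment> \<open>Rescaling multiplies the determinant by \<open>t ^ d\<close>, the power
      \<open>- d / p\<close> of \<open>1 + 3 * p / 2 * ?Q / d\<close>. By
      \<open>1 + z \<le> exp z\<close> this is at least \<open>exp (- (3 / 2 * ?Q))\<close>: the
      budget \<open>d\<close> cancels the exponent \<open>d\<close>, which makes the estimate
      independent of the dimension.\<close>
    have "1 - 3 / 2 * ?Q \<le> exp (- (3 / 2 * ?Q))"
      using exp_ge_add_one_self[of "- (3 / 2 * ?Q)"] by simp
    also have "\<dots> = exp (3 * p / 2 * ?Q / real d) powr (- (real d / p))"
      using d p by (simp add: exp_powr_real)
    also have "\<dots> \<le> (1 + 3 * p / 2 * ?Q / real d) powr (- (real d / p))"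
      using one p exp_ge_add_one_self[of "3 * p / 2 * ?Q / real d"]
      by (intro powr_mono2') auto
    also have "\<dots> = t ^ d"
      using one d by (simp add: t_eq powr_powr flip: powr_realpow)
    finally have t: "1 - 3 / 2 * ?Q \<le> t ^ d" .
    have t0: "0 \<le> t" by (simp add: t_def)
    have "t \<cdot>\<^sub>m (B * ?R) \<in> K"
      unfolding t_def using Bc R E' p Q by (intro rescale) auto
    then have "\<bar>det (t \<cdot>\<^sub>m (B * ?R))\<bar> \<le> m" unfolding m_def by (intro cSUP_upper bdd)
    also have "det (t \<cdot>\<^sub>m (B * ?R)) = t ^ d * (det B * 2)"
      using Bc by (simp add: det_mult[OF Bc R] det_one_plus_rank_one[OF x] unit)
    also have "m \<le> 3 / 2 * \<bar>det B\<bar>" using B(2) by simp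
    finally have "t ^ d * 2 * \<bar>det B\<bar> \<le> 3 / 2 * \<bar>det B\<bar>"
      using t0 by (simp add: abs_mult)
    then have "t ^ d * 2 \<le> 3 / 2" using detB by simp
    with t show ?thesis by linarith
  qed
  then show ?thesis using Bc BE detB by (auto simp: E_def)
qed

text \<open>\<open>U\<close> is \<open>A * B\<close> for a near-maximal \<open>B\<close>, whose
  invertibility preserves the range. For a unit vector, Cauchy-Schwarz bounds the squared row form
  \<open>f\<^sup>2\<close> by the squared row norm \<open>N\<close>; since
  \<open>p / 2 - 1 \<le> 0\<close>, it follows that
  \<open>N powr (p / 2 - 1) * f\<^sup>2 \<le> \<bar>f\<bar> powr p\<close>. The weighted quadratic
  lower bound \<open>1 / 6\<close> thus becomes one for the \<open>p\<close>-th powers, and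
  homogeneity extends it to all \<open>y\<close>.\<close>

lemma Lewis_basis:
  fixes A :: "real mat"
  assumes A: "A \<in> carrier_mat n d" and rank: "vec_space.rank n A = d"
    and p: "0 < p" "p \<le> 2" and d: "0 < d"
  shows "\<exists>U\<in>carrier_mat n d. (\<forall>x\<in>carrier_vec d. \<exists>y\<in>carrier_vec d. A *\<^sub>v x = U *\<^sub>v y) \<and>
    (\<Sum>i<n. row_sq U i powr (p / 2)) \<le> real d \<and>
    (\<forall>y. (\<Sum>j<d. (y j)\<^sup>2) powr (p / 2) \<le> 6 * (\<Sum>i<n. \<bar>row_form U i y\<bar> powr p))"
proof -
  obtain B where B: "B \<in> carrier_mat d d" "det B \<noteq> 0" "(\<Sum>i<n. row_sq (A * B) i powr (p / 2)) \<le> real d"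
    and Q: "\<And>x. x \<in> carrier_vec d \<Longrightarrow> (\<Sum>j<d. (vec_index x j)\<^sup>2) = 1 \<Longrightarrow>
      1 / 6 \<le> (\<Sum>i<n. row_sq (A * B) i powr (p / 2 - 1) * (row_form (A * B) i (vec_index x))\<^sup>2)"
    using near_maximal_position[OF A full_rank_det_gram[OF A rank] p d] by blast
  have AB: "A * B \<in> carrier_mat n d" using A B by simp
  have "\<exists>y\<in>carrier_vec d. A *\<^sub>v x = (A * B) *\<^sub>v y" if x: "x \<in> carrier_vec d" for x
  proof -
    let ?y = "inverse (det B) \<cdot>\<^sub>v (adj_mat B *\<^sub>v x)"
    have y: "adj_mat B *\<^sub>v x \<in> carrier_vec d" using adj_mat(1)[OF B(1)] x by simp
    have "B *\<^sub>v ?y = inverse (det B) \<cdot>\<^sub>v ((B * adj_mat B) *\<^sub>v x)"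
      using B x y adj_mat(1)[OF B(1)] by (simp add: mult_mat_vec)
    also have "\<dots> = x"
      using x B by (intro eq_vecI) (simp_all add: adj_mat(2)[OF B(1)] scalar_prod_def if_distrib
        if_distribR atLeast0LessThan cong: if_cong)
    finally have "(A * B) *\<^sub>v ?y = A *\<^sub>v x" using A B y by simp
    then show ?thesis using y by (intro bexI[of _ ?y]) auto
  qed
  moreover have "(\<Sum>j<d. (y j)\<^sup>2) powr (p / 2) \<le> 6 * (\<Sum>i<n. \<bar>row_form (A * B) i y\<bar> powr p)" for y
  proof (cases "(\<Sum>j<d. (y j)\<^sup>2) = 0")
    case True
    then show ?thesis by (simp add: sum_nonneg)
  next
    case False
    define r where "r = sqrt (\<Sum>j<d. (y j)\<^sup>2)"
    have r: "0 < r" using False by (simp add: r_def less_le sum_nonneg)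
    have r2: "r\<^sup>2 = (\<Sum>j<d. (y j)\<^sup>2)" by (simp add: r_def sum_nonneg)
    define x where "x = Matrix.vec d (\<lambda>j. y j / r)"
    have x: "x \<in> carrier_vec d" by (simp add: x_def)
    have unit: "(\<Sum>j<d. (vec_index x j)\<^sup>2) = 1"
      using r by (simp add: x_def power_divide r2[symmetric] flip: sum_divide_distrib)
    have form: "row_form (A * B) i (vec_index x) = row_form (A * B) i y / r" for i
      using AB by (auto simp: row_form_def x_def sum_divide_distrib intro!: sum.cong)
    have "1 / 6 \<le> (\<Sum>i<n. row_sq (A * B) i powr (p / 2 - 1) * (row_form (A * B) i (vec_index x))\<^sup>2)"
      by (rule Q[OF x unit])
    also have "\<dots> \<le> (\<Sum>i<n. \<bar>row_form (A * B) i (vec_index x)\<bar> powr p)"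
    proof (rule sum_mono)
      fix i
      let ?N = "row_sq (A * B) i" and ?f = "row_form (A * B) i (vec_index x)"
      have le: "?f\<^sup>2 \<le> ?N" using row_form_sq_le[of "A * B" i "vec_index x"] AB B(1) unit by simp
      show "?N powr (p / 2 - 1) * ?f\<^sup>2 \<le> \<bar>?f\<bar> powr p"
      proof (cases "?f = 0")
        case False
        have "?N powr (p / 2 - 1) \<le> (?f\<^sup>2) powr (p / 2 - 1)"
          using False le p by (intro powr_mono2') auto
        then have "?N powr (p / 2 - 1) * ?f\<^sup>2 \<le> (?f\<^sup>2) powr (p / 2 - 1) * ?f\<^sup>2"
          by (intro mult_right_mono) auto
        also have "\<dots> = \<bar>?f\<bar> powr p"
          using False by (simp add: powr_diff power2_powr_half)
        finally show ?thesis .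
      qed simp
    qed
    also have "\<dots> = (\<Sum>i<n. \<bar>row_form (A * B) i y\<bar> powr p) / r powr p"
      using r by (simp add: form powr_divide sum_divide_distrib)
    finally have "r powr p \<le> 6 * (\<Sum>i<n. \<bar>row_form (A * B) i y\<bar> powr p)"
      using r by (simp add: field_simps)
    moreover have "(\<Sum>j<d. (y j)\<^sup>2) powr (p / 2) = r powr p"
      using r by (simp add: powr_powr flip: r2 powr_numeral)
    ultimately show ?thesis by simp
  qed
  ultimately show ?thesis using AB B(3) by blast
qed

subsection \<open>Stable linear forms and Gaussian duality\<close>

lemma standard_stable_real_distribution:
  "standard_stable p D \<Longrightarrow> real_distribution D"
  by (simp add: standard_stable_def)

lemma product_prob_space_const: "prob_space D \<Longrightarrow> product_prob_space (\<lambda>_. D)"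
  by (intro product_prob_spaceI)

text \<open>Independence factors the integral into characteristic functions. It is applied to the
  stable law and, with exponent 2, to \<open>gauss2\<close>.\<close>

lemma integral_iexp_PiM:
  assumes D: "standard_stable p D" and I: "finite I"
  shows "(\<integral>x. iexp (\<Sum>i\<in>I. a i * x i) \<partial>Pi\<^sub>M I (\<lambda>_. D)) = complex_of_real (exp (- (\<Sum>i\<in>I. \<bar>a i\<bar> powr p)))"
proof -
  interpret D: real_distribution D using D by (rule standard_stable_real_distribution)
  interpret product_prob_space "\<lambda>_. D" by (rule product_prob_space_const) unfold_locales
  have "(\<integral>x. iexp (\<Sum>i\<in>I. a i * x i) \<partial>Pi\<^sub>M I (\<lambda>_. D)) = (\<integral>x. (\<Prod>i\<in>I. iexp (a i * x i)) \<partial>Pi\<^sub>M I (\<lambda>_. D))"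
    using I by (simp add: exp_sum sum_distrib_left)
  also have "\<dots> = (\<Prod>i\<in>I. \<integral>x. iexp (a i * x) \<partial>D)"
    using I by (intro product_integral_prod D.integrable_iexp) auto
  also have "\<dots> = (\<Prod>i\<in>I. complex_of_real (exp (- (\<bar>a i\<bar> powr p))))"
    using D by (simp add: standard_stable_def char_def)
  also have "\<dots> = complex_of_real (exp (- (\<Sum>i\<in>I. \<bar>a i\<bar> powr p)))"
    using I by (simp add: exp_sum flip: sum_negf)
  finally show ?thesis .
qed

text \<open>This is the stability property itself: both laws have the characteristic function
  \<open>exp (- (\<bar>t\<bar> powr p * V))\<close> with
  \<open>V = (\<Sum>i\<in>I. \<bar>a i\<bar> powr p)\<close>, and Levy's uniqueness theorem
  identifies them.\<close>

lemma distr_linear_form_stable: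
  assumes D: "standard_stable p D" and p: "0 < p" and I: "finite I"
  shows "distr (Pi\<^sub>M I (\<lambda>_. D)) borel (\<lambda>x. \<Sum>i\<in>I. a i * x i)
    = distr D borel (\<lambda>x. (\<Sum>i\<in>I. \<bar>a i\<bar> powr p) powr (1 / p) * x)"
proof -
  interpret D: real_distribution D using D by (rule standard_stable_real_distribution)
  interpret product_prob_space "\<lambda>_. D" by (rule product_prob_space_const) unfold_locales
  interpret P: prob_space "Pi\<^sub>M I (\<lambda>_. D)" by (intro prob_space_PiM) unfold_locales
  let ?r = "(\<Sum>i\<in>I. \<bar>a i\<bar> powr p) powr (1 / p)"
  show ?thesis
  proof (rule Levy_uniqueness)
    show "real_distribution (distr (Pi\<^sub>M I (\<lambda>_. D)) borel (\<lambda>x. \<Sum>i\<in>I. a i * x i))"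
      by (rule P.real_distribution_distr) measurable
    show "real_distribution (distr D borel (\<lambda>x. ?r * x))"
      by (rule D.real_distribution_distr) measurable
    show "char (distr (Pi\<^sub>M I (\<lambda>_. D)) borel (\<lambda>x. \<Sum>i\<in>I. a i * x i)) = char (distr D borel (\<lambda>x. ?r * x))"
    proof
      fix t
      have "char (distr (Pi\<^sub>M I (\<lambda>_. D)) borel (\<lambda>x. \<Sum>i\<in>I. a i * x i)) t
        = (\<integral>x. iexp (\<Sum>i\<in>I. (t * a i) * x i) \<partial>Pi\<^sub>M I (\<lambda>_. D))"
        unfolding char_def by (subst integral_distr) (simp_all add: sum_distrib_left mult.assoc)
      also have "\<dots> = complex_of_real (exp (- (\<bar>t\<bar> powr p * (\<Sum>i\<in>I. \<bar>a i\<bar> powr p))))"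
        using I by (subst integral_iexp_PiM[OF D]) (simp_all add: abs_mult powr_mult sum_distrib_left)
      also have "\<bar>t\<bar> powr p * (\<Sum>i\<in>I. \<bar>a i\<bar> powr p) = \<bar>t * ?r\<bar> powr p"
        using p by (simp add: abs_mult powr_mult powr_powr sum_nonneg)
      also have "complex_of_real (exp (- \<dots>)) = char D (t * ?r)"
        using D by (simp add: standard_stable_def)
      also have "\<dots> = char (distr D borel (\<lambda>x. ?r * x)) t"
        unfolding char_def by (subst integral_distr) (simp_all add: mult.assoc)
      finally show "char (distr (Pi\<^sub>M I (\<lambda>_. D)) borel (\<lambda>x. \<Sum>i\<in>I. a i * x i)) t
        = char (distr D borel (\<lambda>x. ?r * x)) t" .
    qed
  qed
qed

text \<open>Variance \<open>2\<close> makes the characteristic function \<open>exp (- t\<^sup>2)\<close>, the case \<open>p = 2\<close> of the stable law.\<close>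

definition gauss2 :: "real measure" where
  "gauss2 = distr std_normal_distribution borel (\<lambda>x. sqrt 2 * x)"

lemma standard_stable_gauss2: "standard_stable 2 gauss2"
  unfolding standard_stable_def gauss2_def
proof (intro conjI allI)
  interpret N: real_distribution std_normal_distribution by (rule real_dist_normal_dist)
  show "real_distribution (distr std_normal_distribution borel (\<lambda>x. sqrt 2 * x))"
    by (rule N.real_distribution_distr) measurable
  fix t
  have "char (distr std_normal_distribution borel (\<lambda>x. sqrt 2 * x)) t
      = char std_normal_distribution (t * sqrt 2)"
    unfolding char_def by (subst integral_distr) (simp_all add: mult.assoc)
  also have "\<dots> = complex_of_real (exp (- (\<bar>t\<bar> powr 2)))"
    by (simp add: char_std_normal_distribution power_mult_distrib)
  finally show "char (distr std_normal_distribution borel (\<lambda>x. sqrt 2 * x)) t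
      = complex_of_real (exp (- (\<bar>t\<bar> powr 2)))" .
qed

lemma abs_powr_le_one_plus_sq:
  fixes x p :: real
  assumes "0 \<le> p" "p \<le> 2"
  shows "\<bar>x\<bar> powr p \<le> 1 + x\<^sup>2"
proof (cases "\<bar>x\<bar> \<le> 1")
  case True
  then have "\<bar>x\<bar> powr p \<le> 1" using assms by (simp add: powr_le1)
  then show ?thesis by (simp add: add_increasing2)
next
  case False
  then have "\<bar>x\<bar> powr p \<le> \<bar>x\<bar> powr 2" using assms by (intro powr_mono) auto
  then show ?thesis using False by simp
qed

lemma integrable_gauss2_powr:
  assumes "0 \<le> p" "p \<le> 2"
  shows "integrable gauss2 (\<lambda>x. \<bar>x\<bar> powr p)"
proof -
  interpret N: real_distribution std_normal_distribution by (rule real_dist_normal_dist)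
  have "integrable std_normal_distribution (\<lambda>x. \<bar>sqrt 2 * x\<bar> powr p)"
  proof (rule Bochner_Integration.integrable_bound)
    show "integrable std_normal_distribution (\<lambda>x. 1 + 2 * x\<^sup>2)"
      by (intro Bochner_Integration.integrable_add integrable_mult_right
        integrable_std_normal_distribution_moment) simp
    show "AE x in std_normal_distribution. norm (\<bar>sqrt 2 * x\<bar> powr p) \<le> norm (1 + 2 * x\<^sup>2)"
    proof (rule AE_I2)
      fix x
      show "norm (\<bar>sqrt 2 * x\<bar> powr p) \<le> norm (1 + 2 * x\<^sup>2)"
        using abs_powr_le_one_plus_sq[OF assms, of "sqrt 2 * x"] by (simp add: power_mult_distrib)
    qed
  qed measurable
  then show ?thesis
    unfolding gauss2_def by (subst integrable_distr_eq) auto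
qed

text \<open>Both sides are the expectation of \<open>exp (\<i> c \<Sum>\<^sub>i \<Sum>\<^sub>j x\<^sub>i u\<^sub>i\<^sub>j g\<^sub>j)\<close> over independent stable \<open>x\<close> and Gaussian \<open>g\<close>,
  which turns the Euclidean norm of a stable vector into a sum of scalar stable tails.\<close>

lemma gaussian_stable_duality:
  assumes D: "standard_stable p D" and I: "finite I" and J: "finite J"
  shows "(\<integral>x. exp (- (\<Sum>j\<in>J. (c * (\<Sum>i\<in>I. x i * u i j))\<^sup>2)) \<partial>Pi\<^sub>M I (\<lambda>_. D))
    = (\<integral>g. exp (- (\<Sum>i\<in>I. \<bar>c * (\<Sum>j\<in>J. u i j * g j)\<bar> powr p)) \<partial>Pi\<^sub>M J (\<lambda>_. gauss2))"
proof -
  interpret D: real_distribution D using D by (rule standard_stable_real_distribution)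
  interpret G: real_distribution gauss2
    by (rule standard_stable_real_distribution[OF standard_stable_gauss2])
  interpret P: prob_space "Pi\<^sub>M I (\<lambda>_. D)" by (intro prob_space_PiM) unfold_locales
  interpret Q: prob_space "Pi\<^sub>M J (\<lambda>_. gauss2)" by (intro prob_space_PiM) unfold_locales
  interpret PQ: pair_prob_space "Pi\<^sub>M I (\<lambda>_. D)" "Pi\<^sub>M J (\<lambda>_. gauss2)" ..
  let ?f = "\<lambda>x g. iexp (\<Sum>i\<in>I. \<Sum>j\<in>J. c * x i * u i j * g j)"
  have "complex_of_real (\<integral>x. exp (- (\<Sum>j\<in>J. (c * (\<Sum>i\<in>I. x i * u i j))\<^sup>2)) \<partial>Pi\<^sub>M I (\<lambda>_. D))
      = (\<integral>x. (\<integral>g. iexp (\<Sum>j\<in>J. (c * (\<Sum>i\<in>I. x i * u i j)) * g j) \<partial>Pi\<^sub>M J (\<lambda>_. gauss2)) \<partial>Pi\<^sub>M I (\<lambda>_. D))"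
    by (subst integral_iexp_PiM[OF standard_stable_gauss2 J]) simp
  also have "\<dots> = (\<integral>x. (\<integral>g. ?f x g \<partial>Pi\<^sub>M J (\<lambda>_. gauss2)) \<partial>Pi\<^sub>M I (\<lambda>_. D))"
    by (subst sum.swap) (simp add: sum_distrib_left sum_distrib_right mult_ac)
  also have "\<dots> = (\<integral>g. (\<integral>x. ?f x g \<partial>Pi\<^sub>M I (\<lambda>_. D)) \<partial>Pi\<^sub>M J (\<lambda>_. gauss2))"
    by (intro PQ.Fubini_integral[symmetric] PQ.integrable_const_bound[where B = 1]) auto
  also have "\<dots> = (\<integral>g. (\<integral>x. iexp (\<Sum>i\<in>I. (c * (\<Sum>j\<in>J. u i j * g j)) * x i) \<partial>Pi\<^sub>M I (\<lambda>_. D)) \<partial>Pi\<^sub>M J (\<lambda>_. gauss2))"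
    by (simp add: sum_distrib_left sum_distrib_right mult_ac)
  also have "\<dots> = complex_of_real (\<integral>g. exp (- (\<Sum>i\<in>I. \<bar>c * (\<Sum>j\<in>J. u i j * g j)\<bar> powr p)) \<partial>Pi\<^sub>M J (\<lambda>_. gauss2))"
    by (subst integral_iexp_PiM[OF D I]) simp
  finally show ?thesis by (simp only: of_real_eq_iff)
qed

text \<open>By stability with exponent 2 the form is distributed as a single Gaussian times the
  Euclidean norm of \<open>v\<close>. This is how row norms arise on the Gaussian side of the
  duality.\<close>

lemma integral_gauss2_linear_form_powr:
  assumes p: "0 < p" "p \<le> 2" and J: "finite J"
  shows "integrable (Pi\<^sub>M J (\<lambda>_. gauss2)) (\<lambda>g. \<bar>\<Sum>j\<in>J. v j * g j\<bar> powr p)" (is ?int)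
    and "(\<integral>g. \<bar>\<Sum>j\<in>J. v j * g j\<bar> powr p \<partial>Pi\<^sub>M J (\<lambda>_. gauss2))
      = (\<Sum>j\<in>J. (v j)\<^sup>2) powr (p / 2) * (\<integral>x. \<bar>x\<bar> powr p \<partial>gauss2)" (is ?eq)
proof -
  interpret G: real_distribution gauss2
    by (rule standard_stable_real_distribution[OF standard_stable_gauss2])
  let ?r = "(\<Sum>j\<in>J. (v j)\<^sup>2) powr (1 / 2)"
  have distr: "distr (Pi\<^sub>M J (\<lambda>_. gauss2)) borel (\<lambda>g. \<Sum>j\<in>J. v j * g j) = distr gauss2 borel (\<lambda>x. ?r * x)"
    using distr_linear_form_stable[OF standard_stable_gauss2 _ J, of v] by simp
  have r: "\<bar>?r * x\<bar> powr p = (\<Sum>j\<in>J. (v j)\<^sup>2) powr (p / 2) * \<bar>x\<bar> powr p" for x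
    by (simp add: abs_mult powr_mult powr_powr)
  have "integrable (distr gauss2 borel (\<lambda>x. ?r * x)) (\<lambda>x. \<bar>x\<bar> powr p)"
    using integrable_gauss2_powr[of p] p by (subst integrable_distr_eq) (auto simp: r)
  then show ?int
    unfolding distr[symmetric] by (subst (asm) integrable_distr_eq) auto
  have "(\<integral>g. \<bar>\<Sum>j\<in>J. v j * g j\<bar> powr p \<partial>Pi\<^sub>M J (\<lambda>_. gauss2))
      = (\<integral>x. \<bar>x\<bar> powr p \<partial>distr (Pi\<^sub>M J (\<lambda>_. gauss2)) borel (\<lambda>g. \<Sum>j\<in>J. v j * g j))"
    by (subst integral_distr) auto
  also have "\<dots> = (\<integral>x. \<bar>?r * x\<bar> powr p \<partial>gauss2)"
    unfolding distr by (subst integral_distr) auto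
  finally show ?eq by (simp only: r) simp
qed

definition gauss_moment :: "real \<Rightarrow> real" where
  "gauss_moment p = (\<integral>x. \<bar>x\<bar> powr p \<partial>gauss2)"

lemma gauss_moment_nonneg: "0 \<le> gauss_moment p"
  by (simp add: gauss_moment_def)

text \<open>Moments of order \<open>p\<close> may be infinite, so the tail is tested with the
  bounded function \<open>1 - exp (- (c\<^sup>2 * W))\<close>, where \<open>W\<close> is the squared
  length. With \<open>c = \<tau> powr (- (1 / p))\<close> it is at least \<open>1 / 2\<close> on the
  event. Duality turns its expectation into a Gaussian one, where
  \<open>1 - exp (- y) \<le> y\<close> and \<open>c powr p = 1 / \<tau>\<close> leave finite
  Gaussian moments.\<close>

lemma stable_vector_tail:
  assumes D: "standard_stable p D" and p: "0 < p" "p \<le> 2" and I: "finite I" and J: "finite J"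
    and \<tau>: "0 < \<tau>"
  shows "\<P>(x in Pi\<^sub>M I (\<lambda>_. D). \<tau> \<le> (\<Sum>j\<in>J. (\<Sum>i\<in>I. x i * u i j)\<^sup>2) powr (p / 2))
    \<le> 2 * gauss_moment p / \<tau> * (\<Sum>i\<in>I. (\<Sum>j\<in>J. (u i j)\<^sup>2) powr (p / 2))"
proof -
  interpret D: real_distribution D using D by (rule standard_stable_real_distribution)
  interpret G: real_distribution gauss2
    by (rule standard_stable_real_distribution[OF standard_stable_gauss2])
  interpret P: prob_space "Pi\<^sub>M I (\<lambda>_. D)" by (intro prob_space_PiM) unfold_locales
  interpret Q: prob_space "Pi\<^sub>M J (\<lambda>_. gauss2)" by (intro prob_space_PiM) unfold_locales
  let ?P = "Pi\<^sub>M I (\<lambda>_. D)" and ?Q = "Pi\<^sub>M J (\<lambda>_. gauss2)"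
  let ?W = "\<lambda>x. \<Sum>j\<in>J. (\<Sum>i\<in>I. x i * u i j)\<^sup>2"
  define c where "c = \<tau> powr (- (1 / p))"
  have c: "0 < c" using \<tau> by (simp add: c_def)
  have "c powr p = \<tau> powr (- 1)" using p by (simp add: c_def powr_powr)
  then have cp: "c powr p = 1 / \<tau>" using \<tau> by (simp add: powr_minus_divide)
  have large: "1 \<le> c\<^sup>2 * ?W x" if "\<tau> \<le> ?W x powr (p / 2)" for x
  proof -
    have "\<tau> powr (2 / p) \<le> (?W x powr (p / 2)) powr (2 / p)"
      using that \<tau> p by (intro powr_mono2) auto
    also have "\<dots> = ?W x" using p by (simp add: powr_powr sum_nonneg)
    finally have "c\<^sup>2 * \<tau> powr (2 / p) \<le> c\<^sup>2 * ?W x" by (intro mult_left_mono) auto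
    moreover have "c\<^sup>2 = inverse (\<tau> powr (2 / p))"
      using \<tau> by (simp add: c_def powr_powr powr_minus[symmetric] flip: powr_numeral)
    ultimately show ?thesis using \<tau> by simp
  qed
  have half: "1 / 2 \<le> 1 - exp (- (c\<^sup>2 * ?W x))" if "\<tau> \<le> ?W x powr (p / 2)" for x
  proof -
    have "exp (- (c\<^sup>2 * ?W x)) \<le> exp (- 1)" using large[OF that] by simp
    also have "exp (- 1) \<le> (1 / 2 :: real)"
      using exp_ge_add_one_self[of "1 :: real"] by (simp add: exp_minus field_simps)
    finally show ?thesis by simp
  qed
  have "\<P>(x in ?P. \<tau> \<le> ?W x powr (p / 2)) = (\<integral>x. indicator {x \<in> space ?P. \<tau> \<le> ?W x powr (p / 2)} x \<partial>?P)"
    by simp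
  also have "\<dots> \<le> (\<integral>x. 2 * (1 - exp (- (\<Sum>j\<in>J. (c * (\<Sum>i\<in>I. x i * u i j))\<^sup>2))) \<partial>?P)"
  proof (rule integral_mono)
    show "integrable ?P (\<lambda>x. 2 * (1 - exp (- (\<Sum>j\<in>J. (c * (\<Sum>i\<in>I. x i * u i j))\<^sup>2))))"
      by (intro P.integrable_const_bound[where B = 2]) (auto simp: sum_nonneg)
    show "integrable ?P (indicator {x \<in> space ?P. \<tau> \<le> ?W x powr (p / 2)} :: _ \<Rightarrow> real)"
      by (intro P.integrable_const_bound[where B = 1]) (auto simp: indicator_def)
    fix x
    have eq: "(\<Sum>j\<in>J. (c * (\<Sum>i\<in>I. x i * u i j))\<^sup>2) = c\<^sup>2 * ?W x"
      by (simp add: power_mult_distrib flip: sum_distrib_left)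
    have "0 \<le> c\<^sup>2 * ?W x" by (simp add: sum_nonneg)
    then show "indicator {x \<in> space ?P. \<tau> \<le> ?W x powr (p / 2)} x
        \<le> 2 * (1 - exp (- (\<Sum>j\<in>J. (c * (\<Sum>i\<in>I. x i * u i j))\<^sup>2)))"
      using half[of x] unfolding eq by (auto simp: indicator_def)
  qed
  also have "\<dots> = 2 * (1 - (\<integral>x. exp (- (\<Sum>j\<in>J. (c * (\<Sum>i\<in>I. x i * u i j))\<^sup>2)) \<partial>?P))"
    by (subst integral_mult_right_zero, subst Bochner_Integration.integral_diff)
       (auto intro!: P.integrable_const_bound[where B = 1] simp: P.prob_space sum_nonneg)
  also have "\<dots> = 2 * (\<integral>g. 1 - exp (- (\<Sum>i\<in>I. \<bar>c * (\<Sum>j\<in>J. u i j * g j)\<bar> powr p)) \<partial>?Q)"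
    unfolding gaussian_stable_duality[OF D I J]
    by (subst Bochner_Integration.integral_diff)
       (auto intro!: Q.integrable_const_bound[where B = 1] simp: Q.prob_space sum_nonneg)
  also have "\<dots> \<le> 2 * (\<integral>g. (\<Sum>i\<in>I. 1 / \<tau> * \<bar>\<Sum>j\<in>J. u i j * g j\<bar> powr p) \<partial>?Q)"
  proof (intro mult_left_mono integral_mono)
    show "integrable ?Q (\<lambda>g. 1 - exp (- (\<Sum>i\<in>I. \<bar>c * (\<Sum>j\<in>J. u i j * g j)\<bar> powr p)))"
      by (intro Q.integrable_const_bound[where B = 1]) (auto simp: sum_nonneg)
    show "integrable ?Q (\<lambda>g. \<Sum>i\<in>I. 1 / \<tau> * \<bar>\<Sum>j\<in>J. u i j * g j\<bar> powr p)"
      by (intro Bochner_Integration.integrable_sum integrable_mult_right integral_gauss2_linear_form_powr p J)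
    fix g
    have "1 - exp (- y) \<le> y" for y :: real using exp_ge_add_one_self[of "- y"] by linarith
    then have "1 - exp (- (\<Sum>i\<in>I. \<bar>c * (\<Sum>j\<in>J. u i j * g j)\<bar> powr p)) \<le> (\<Sum>i\<in>I. \<bar>c * (\<Sum>j\<in>J. u i j * g j)\<bar> powr p)" .
    also have "\<dots> = (\<Sum>i\<in>I. 1 / \<tau> * \<bar>\<Sum>j\<in>J. u i j * g j\<bar> powr p)"
      using c by (simp add: abs_mult powr_mult cp)
    finally show "1 - exp (- (\<Sum>i\<in>I. \<bar>c * (\<Sum>j\<in>J. u i j * g j)\<bar> powr p))
        \<le> (\<Sum>i\<in>I. 1 / \<tau> * \<bar>\<Sum>j\<in>J. u i j * g j\<bar> powr p)" .
  qed simp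
  also have "\<dots> = 2 * (\<Sum>i\<in>I. 1 / \<tau> * ((\<Sum>j\<in>J. (u i j)\<^sup>2) powr (p / 2) * gauss_moment p))"
    unfolding gauss_moment_def
    by (subst Bochner_Integration.integral_sum)
       (simp_all add: integral_gauss2_linear_form_powr p J)
  also have "\<dots> = 2 * gauss_moment p / \<tau> * (\<Sum>i\<in>I. (\<Sum>j\<in>J. (u i j)\<^sup>2) powr (p / 2))"
    by (simp add: sum_distrib_left mult_ac)
  finally show ?thesis .
qed

subsection \<open>Independent rows\<close>

lemma prob_space_iid_entries:
  "standard_stable p D \<Longrightarrow> prob_space (iid_entries D s n)"
  unfolding iid_entries_def
  by (intro prob_space_PiM real_distribution.axioms(1) standard_stable_real_distribution)

lemma distr_iid_entries_row:
  assumes D: "standard_stable p D" and k: "k < s"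
  shows "distr (iid_entries D s n) (Pi\<^sub>M {..<n} (\<lambda>_. D)) (\<lambda>g. \<lambda>i\<in>{..<n}. g (k, i)) = Pi\<^sub>M {..<n} (\<lambda>_. D)"
  unfolding iid_entries_def
  using k D by (intro distr_PiM_reindex) (auto simp: inj_on_def intro: real_distribution.axioms(1) standard_stable_real_distribution)

text \<open>Coordinates of a product measure are independent, and functions of disjoint blocks of
  them, here the rows, remain so. Positive dimensions keep the index set nonempty, as the product
  criterion for independence demands.\<close>

lemma indep_linear_forms:
  assumes D: "standard_stable p D" and pos: "0 < s" "0 < n"
  shows "prob_space.indep_vars (iid_entries D s n) (\<lambda>_. borel) (\<lambda>k g. \<Sum>i<n. g (k, i) * a i) {..<s}"
proof -
  interpret D: real_distribution D using D by (rule standard_stable_real_distribution)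
  interpret M: prob_space "iid_entries D s n" using D by (rule prob_space_iid_entries)
  let ?I = "{..<s} \<times> {..<n}"
  have rv: "M.random_variable D (\<lambda>g. g e)" if "e \<in> ?I" for e
    unfolding iid_entries_def using that by measurable
  have "distr (iid_entries D s n) (Pi\<^sub>M ?I (\<lambda>_. D)) (\<lambda>g. \<lambda>e\<in>?I. g e) = distr (iid_entries D s n) (iid_entries D s n) (\<lambda>g. g)"
    unfolding iid_entries_def by (intro distr_cong) (auto simp: space_PiM PiE_restrict)
  also have "\<dots> = Pi\<^sub>M ?I (\<lambda>_. D)"
    by (simp add: distr_id2 iid_entries_def)
  also have "\<dots> = Pi\<^sub>M ?I (\<lambda>e. distr (iid_entries D s n) D (\<lambda>g. g e))"
    unfolding iid_entries_def
    by (intro PiM_cong distr_PiM_component[symmetric]) (auto intro: D.prob_space_axioms)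
  finally have "M.indep_vars (\<lambda>_. D) (\<lambda>e g. g e) ?I"
    using pos by (subst M.indep_vars_iff_distr_eq_PiM') (auto intro: rv)
  then have "M.indep_vars (\<lambda>k. Pi\<^sub>M ({k} \<times> {..<n}) (\<lambda>_. D)) (\<lambda>k g. restrict (\<lambda>e. g e) ({k} \<times> {..<n})) {..<s}"
    by (intro M.indep_vars_restrict) (auto simp: disjoint_family_on_def)
  then have "M.indep_vars (\<lambda>_. borel) (\<lambda>k g. \<Sum>i<n. (restrict (\<lambda>e. g e) ({k} \<times> {..<n})) (k, i) * a i) {..<s}"
    by (rule M.indep_vars_compose2) measurable
  then show ?thesis by simp
qed

lemma integral_linear_form_iid:
  fixes f :: "real \<Rightarrow> real"
  assumes D: "standard_stable p D" and p: "0 < p" and k: "k < s" and f: "f \<in> borel_measurable borel"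
  shows "(\<integral>g. f (\<Sum>i<n. g (k, i) * a i) \<partial>iid_entries D s n)
    = (\<integral>x. f ((\<Sum>i<n. \<bar>a i\<bar> powr p) powr (1 / p) * x) \<partial>D)"
proof -
  interpret D: real_distribution D using D by (rule standard_stable_real_distribution)
  have meas: "(\<lambda>g. \<lambda>i\<in>{..<n}. g (k, i)) \<in> measurable (iid_entries D s n) (Pi\<^sub>M {..<n} (\<lambda>_. D))"
    unfolding iid_entries_def using k by (intro measurable_restrict measurable_component_singleton) auto
  have "(\<integral>g. f (\<Sum>i<n. g (k, i) * a i) \<partial>iid_entries D s n)
      = (\<integral>g. f (\<Sum>i<n. (\<lambda>i\<in>{..<n}. g (k, i)) i * a i) \<partial>iid_entries D s n)"
    by simp
  also have "\<dots> = (\<integral>x. f (\<Sum>i<n. x i * a i) \<partial>Pi\<^sub>M {..<n} (\<lambda>_. D))"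
    using f by (subst distr_iid_entries_row[OF D k, symmetric], subst integral_distr[OF meas]) simp_all
  also have "\<dots> = (\<integral>y. f y \<partial>distr (Pi\<^sub>M {..<n} (\<lambda>_. D)) borel (\<lambda>x. \<Sum>i<n. a i * x i))"
    using f by (subst integral_distr) (simp_all add: mult.commute)
  also have "\<dots> = (\<integral>x. f ((\<Sum>i<n. \<bar>a i\<bar> powr p) powr (1 / p) * x) \<partial>D)"
    using f by (subst distr_linear_form_stable[OF D p]) (simp_all add: integral_distr)
  finally show ?thesis .
qed

section \<open>Laplace transforms, lower tails and sums with weak-type tails\<close>

definition laplace :: "real \<Rightarrow> real measure \<Rightarrow> real" where
  "laplace p D = (\<integral>x. exp (- (\<bar>x\<bar> powr p)) \<partial>D)"

text \<open>The value 1 would force the variable to vanish almost everywhere, and its characteristic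
  function at 1 would be 1 instead of \<open>exp (- 1)\<close>. Strictness makes the rate
  \<open>\<kappa>\<close> of the lower tail positive.\<close>

lemma laplace_bounds:
  assumes D: "standard_stable p D"
  shows "0 < laplace p D" and "laplace p D < 1"
proof -
  interpret D: real_distribution D using D by (rule standard_stable_real_distribution)
  have int: "integrable D (\<lambda>x. exp (- (\<bar>x\<bar> powr p)))"
    by (intro D.integrable_const_bound[where B = 1]) auto
  show "0 < laplace p D"
    unfolding laplace_def using D.integral_less_AE_space[of "\<lambda>_. 0", OF _ int] D.emeasure_space_1
    by simp
  show "laplace p D < 1"
  proof (rule ccontr)
    assume "\<not> laplace p D < 1"
    moreover have "laplace p D \<le> (\<integral>x. 1 \<partial>D)"
      unfolding laplace_def by (intro integral_mono int) auto
    ultimately have "(\<integral>x. exp (- (\<bar>x\<bar> powr p)) \<partial>D) = (\<integral>x. 1 \<partial>D)"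
      using D.prob_space by (simp add: laplace_def)
    then have "AE x in D. exp (- (\<bar>x\<bar> powr p)) = (1 :: real)"
      by (intro integral_ineq_eq_0_then_AE int) auto
    then have "AE x in D. x = 0" by simp
    then have "char D 1 = (\<integral>x. 1 \<partial>D)"
      unfolding char_def by (intro integral_cong_AE) auto
    then show False using D D.prob_space by (simp add: standard_stable_def)
  qed
qed

text \<open>Chernoff's method with the single parameter \<open>1 / V\<close>, where \<open>V\<close>
  is the sum of the \<open>\<bar>a i\<bar> powr p\<close>. By stability each row contributes the
  factor \<open>laplace p D = exp (- 2 * \<kappa>)\<close>. The threshold
  \<open>exp (- (\<kappa> * s))\<close> in Markov's inequality spends half of the exponent, and the
  other half remains as the bound.\<close>

lemma stable_anticoncentration:
  assumes D: "standard_stable p D" and p: "0 < p" and pos: "0 < s" "0 < n"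
    and V: "0 < (\<Sum>i<n. \<bar>a i\<bar> powr p)"
  defines "\<kappa> \<equiv> - ln (laplace p D) / 2"
  shows "\<P>(g in iid_entries D s n. (\<Sum>k<s. \<bar>\<Sum>i<n. g (k, i) * a i\<bar> powr p) \<le> \<kappa> * s * (\<Sum>i<n. \<bar>a i\<bar> powr p))
    \<le> exp (- (\<kappa> * s))"
proof -
  interpret D: real_distribution D using D by (rule standard_stable_real_distribution)
  interpret M: prob_space "iid_entries D s n" using D by (rule prob_space_iid_entries)
  let ?M = "iid_entries D s n" and ?V = "\<Sum>i<n. \<bar>a i\<bar> powr p"
  let ?R = "\<lambda>k g. \<Sum>i<n. g (k, i) * a i"
  have [measurable]: "?R k \<in> borel_measurable ?M" if "k < s" for k
    unfolding iid_entries_def by measurable (use that in auto)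
  have indep: "M.indep_vars (\<lambda>_. borel) (\<lambda>k g. exp (- (\<bar>?R k g\<bar> powr p / ?V))) {..<s}"
    by (rule M.indep_vars_compose2[OF indep_linear_forms[OF D pos]]) measurable
  have int: "integrable ?M (\<lambda>g. exp (- (\<bar>?R k g\<bar> powr p / ?V)))" if "k < s" for k
    using that V by (intro M.integrable_const_bound[where B = 1]) auto
  have one: "(\<integral>g. exp (- (\<bar>?R k g\<bar> powr p / ?V)) \<partial>?M) = laplace p D" if "k < s" for k
  proof -
    have "(\<integral>g. exp (- (\<bar>?R k g\<bar> powr p / ?V)) \<partial>?M) = (\<integral>x. exp (- (\<bar>?V powr (1 / p) * x\<bar> powr p / ?V)) \<partial>D)"
      by (rule integral_linear_form_iid[OF D p that, where f = "\<lambda>r. exp (- (\<bar>r\<bar> powr p / ?V))"]) measurable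
    also have "\<dots> = laplace p D"
      using V p by (simp add: laplace_def abs_mult powr_mult powr_powr)
    finally show ?thesis .
  qed
  have "\<P>(g in ?M. (\<Sum>k<s. \<bar>?R k g\<bar> powr p) \<le> \<kappa> * s * ?V)
      \<le> \<P>(g in ?M. exp (- (\<kappa> * s)) \<le> (\<Prod>k<s. exp (- (\<bar>?R k g\<bar> powr p / ?V))))"
  proof (rule M.finite_measure_mono)
    show "{g \<in> space ?M. exp (- (\<kappa> * s)) \<le> (\<Prod>k<s. exp (- (\<bar>?R k g\<bar> powr p / ?V)))} \<in> sets ?M"
      by measurable auto
    show "{g \<in> space ?M. (\<Sum>k<s. \<bar>?R k g\<bar> powr p) \<le> \<kappa> * s * ?V}
        \<subseteq> {g \<in> space ?M. exp (- (\<kappa> * s)) \<le> (\<Prod>k<s. exp (- (\<bar>?R k g\<bar> powr p / ?V)))}"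
      using V by (auto simp: pos_divide_le_eq sum_negf simp flip: exp_sum sum_divide_distrib)
  qed
  also have "\<dots> \<le> (\<integral>g. (\<Prod>k<s. exp (- (\<bar>?R k g\<bar> powr p / ?V))) \<partial>?M) / exp (- (\<kappa> * s))"
    using M.indep_vars_integrable[OF _ indep] int
    by (intro integral_Markov_inequality_measure[where A = "space ?M"])
       (auto intro!: prod_nonneg AE_I2)
  also have "(\<integral>g. (\<Prod>k<s. exp (- (\<bar>?R k g\<bar> powr p / ?V))) \<partial>?M) = laplace p D ^ s"
    using M.indep_vars_lebesgue_integral[OF _ indep] int by (simp add: one)
  also have "laplace p D ^ s = exp (- (2 * \<kappa> * s))"
    using laplace_bounds[OF D] by (simp add: \<kappa>_def exp_of_nat2_mult)
  also have "exp (- (2 * \<kappa> * s)) / exp (- (\<kappa> * s)) = exp (- (\<kappa> * s))"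
    by (simp flip: exp_diff)
  finally show ?thesis .
qed

text \<open>The highest level \<open>l\<close> reached by \<open>w\<close> pays alone:
  \<open>w\<close> is below \<open>2 ^ Suc l * d\<close>, the weight of that level. The leading
  \<open>d\<close> covers a \<open>w\<close> that reaches no level.\<close>

lemma dyadic_bound:
  fixes w d :: real
  assumes "0 \<le> d" and "w < d * 2 ^ L"
  shows "w \<le> d + (\<Sum>l<L. 2 ^ Suc l * d * (if 2 ^ l * d \<le> w then 1 else 0))"
  using assms
proof (induction L)
  case (Suc L)
  show ?case
  proof (cases "w < d * 2 ^ L")
    case True
    then have "w \<le> d + (\<Sum>l<L. 2 ^ Suc l * d * (if 2 ^ l * d \<le> w then 1 else 0))"
      using Suc by blast
    moreover have "0 \<le> 2 * 2 ^ L * d" using Suc.prems by simp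
    ultimately show ?thesis using True by (simp add: mult.commute)
  next
    case False
    have "0 \<le> (\<Sum>l<L. 2 ^ Suc l * d * (if 2 ^ l * d \<le> w then 1 else 0))"
      using Suc.prems by (intro sum_nonneg) auto
    then show ?thesis using False Suc.prems by (simp add: mult.commute)
  qed
qed simp

text \<open>Level \<open>l\<close> has weight \<open>2 ^ Suc l * d\<close> and probability at most
  \<open>C / 2 ^ l\<close>, so all levels contribute the same \<open>2 * C * d\<close>, and a
  possibly infinite mean becomes \<open>2 * C * d * L\<close> after truncation. Markov's inequality
  with a factor 4 yields the 8 and the probability \<open>1 / 4\<close>. By the choice of
  \<open>L\<close>, some summand passes the truncation \<open>d * 2 ^ L\<close> with probability at
  most \<open>1 / 4\<close> as well.\<close>

lemma weak_type_sum_bound: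
  fixes W :: "nat \<Rightarrow> 'a \<Rightarrow> real"
  assumes M: "prob_space M" and W[measurable]: "\<And>k. k < s \<Longrightarrow> W k \<in> borel_measurable M"
    and tail: "\<And>k \<tau>. k < s \<Longrightarrow> 0 < \<tau> \<Longrightarrow> \<P>(x in M. \<tau> \<le> W k x) \<le> C * d / \<tau>"
    and d: "0 < d" and C: "1 \<le> C" and s: "0 < s" and L: "4 * C * s \<le> 2 ^ L"
  shows "\<P>(x in M. s * d * (1 + 8 * C * L) < (\<Sum>k<s. W k x)) \<le> 1 / 2"
proof -
  interpret prob_space M by fact
  let ?ind = "\<lambda>l k x. if 2 ^ l * d \<le> W k x then 1 else 0 :: real"
  let ?Y = "\<lambda>x. \<Sum>k<s. \<Sum>l<L. 2 ^ Suc l * d * ?ind l k x"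
  have L0: "0 < L"
  proof (rule ccontr)
    assume "\<not> 0 < L"
    then have "4 * C * s \<le> 1" using L by simp
    moreover have "1 * 1 \<le> C * s" using C s by (intro mult_mono) auto
    ultimately show False by simp
  qed
  have int: "integrable M (?ind l k)" if "k < s" for l k
    using that by (intro integrable_const_bound[where B = 1]) auto
  have ind_le: "(\<integral>x. ?ind l k x \<partial>M) \<le> C / 2 ^ l" if "k < s" for l k
  proof -
    have "(\<integral>x. ?ind l k x \<partial>M) = (\<integral>x. indicator {x \<in> space M. 2 ^ l * d \<le> W k x} x \<partial>M)"
      by (intro Bochner_Integration.integral_cong) (auto simp: indicator_def)
    also have "\<dots> = prob ({x \<in> space M. 2 ^ l * d \<le> W k x} \<inter> space M)" by simp
    also have "prob ({x \<in> space M. 2 ^ l * d \<le> W k x} \<inter> space M) = \<P>(x in M. 2 ^ l * d \<le> W k x)"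
      by (rule arg_cong[where f = prob]) auto
    also have "\<dots> \<le> C * d / (2 ^ l * d)" using that d by (intro tail) auto
    finally show ?thesis using d by simp
  qed
  have intY: "integrable M ?Y" using int by (intro Bochner_Integration.integrable_sum integrable_mult_right) auto
  have "(\<integral>x. ?Y x \<partial>M) = (\<Sum>k<s. \<Sum>l<L. 2 ^ Suc l * d * (\<integral>x. ?ind l k x \<partial>M))"
    using int by (subst Bochner_Integration.integral_sum)
      (auto intro!: Bochner_Integration.integrable_sum sum.cong Bochner_Integration.integral_sum[THEN trans])
  also have "\<dots> \<le> (\<Sum>k<s. \<Sum>l<L. 2 ^ Suc l * d * (C / 2 ^ l))"
    using ind_le d by (intro sum_mono mult_left_mono) auto
  also have "\<dots> = 2 * s * L * d * C" by simp
  finally have EY: "(\<integral>x. ?Y x \<partial>M) \<le> 2 * s * L * d * C" .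
  have pos: "0 < 8 * s * L * d * C" using s L0 d C by simp
  have "\<P>(x in M. 8 * s * L * d * C \<le> ?Y x) \<le> (\<integral>x. ?Y x \<partial>M) / (8 * s * L * d * C)"
    using pos d by (intro integral_Markov_inequality_measure[where A = "space M"] intY) (auto intro!: sum_nonneg AE_I2)
  also have "\<dots> \<le> (2 * s * L * d * C) / (8 * s * L * d * C)"
    using pos EY by (intro divide_right_mono) auto
  also have "\<dots> = 1 / 4" using s L0 d C by (simp add: field_simps)
  finally have P1: "\<P>(x in M. 8 * s * L * d * C \<le> ?Y x) \<le> 1 / 4" .
  have "prob (\<Union>k<s. {x \<in> space M. d * 2 ^ L \<le> W k x}) \<le> (\<Sum>k<s. \<P>(x in M. d * 2 ^ L \<le> W k x))"
    by (intro finite_measure_subadditive_finite) auto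
  also have "\<dots> \<le> (\<Sum>k<s. C * d / (d * 2 ^ L))"
    using d by (intro sum_mono tail) auto
  also have "\<dots> = s * C / 2 ^ L" using d by simp
  also have "\<dots> \<le> 1 / 4" using L by (simp add: field_simps)
  finally have P2: "prob (\<Union>k<s. {x \<in> space M. d * 2 ^ L \<le> W k x}) \<le> 1 / 4" .
  have sub: "{x \<in> space M. s * d * (1 + 8 * C * L) < (\<Sum>k<s. W k x)}
      \<subseteq> {x \<in> space M. 8 * s * L * d * C \<le> ?Y x} \<union> (\<Union>k<s. {x \<in> space M. d * 2 ^ L \<le> W k x})"
  proof (rule subsetI, rule ccontr)
    fix x assume x: "x \<in> {x \<in> space M. s * d * (1 + 8 * C * L) < (\<Sum>k<s. W k x)}"
      and "x \<notin> {x \<in> space M. 8 * s * L * d * C \<le> ?Y x} \<union> (\<Union>k<s. {x \<in> space M. d * 2 ^ L \<le> W k x})"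
    then have Y: "?Y x < 8 * s * L * d * C" and less: "\<And>k. k < s \<Longrightarrow> W k x < d * 2 ^ L"
      by (auto simp: not_le)
    have "(\<Sum>k<s. W k x) \<le> (\<Sum>k<s. d + (\<Sum>l<L. 2 ^ Suc l * d * ?ind l k x))"
      using less d by (intro sum_mono dyadic_bound) auto
    also have "\<dots> = s * d + ?Y x" by (simp add: sum.distrib)
    also have "\<dots> \<le> s * d * (1 + 8 * C * L)" using Y by (simp add: algebra_simps)
    finally show False using x by simp
  qed
  have "\<P>(x in M. s * d * (1 + 8 * C * L) < (\<Sum>k<s. W k x))
      \<le> prob ({x \<in> space M. 8 * s * L * d * C \<le> ?Y x} \<union> (\<Union>k<s. {x \<in> space M. d * 2 ^ L \<le> W k x}))"
    by (intro finite_measure_mono sub) auto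
  also have "\<dots> \<le> 1 / 4 + 1 / 4"
    by (intro order_trans[OF measure_Un_le] add_mono P1 P2) auto
  finally show ?thesis by simp
qed

subsection \<open>Energies and the lattice net\<close>

definition lp_form :: "real \<Rightarrow> real mat \<Rightarrow> (nat \<Rightarrow> real) \<Rightarrow> real" where
  "lp_form p U y = (\<Sum>i<dim_row U. \<bar>row_form U i y\<bar> powr p)"

text \<open>The \<open>p\<close>-th power of the mixed norm that is Euclidean along the rows and
  \<open>p\<close> across them. By Cauchy-Schwarz it dominates \<open>lp_form\<close> in all
  directions at once, so one random event controls the dilation of every vector.\<close>

definition energy :: "real \<Rightarrow> real mat \<Rightarrow> real" where
  "energy p U = (\<Sum>i<dim_row U. row_sq U i powr (p / 2))"

lemma lp_form_nonneg [simp]: "0 \<le> lp_form p U y"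
  by (simp add: lp_form_def sum_nonneg)

lemma lp_norm_mult_vec:
  assumes "U \<in> carrier_mat n d" and "y \<in> carrier_vec d"
  shows "lp_norm p (U *\<^sub>v y) = lp_form p U (vec_index y) powr (1 / p)"
  using assms by (simp add: lp_norm_def lp_form_def row_form_def scalar_prod_def atLeast0LessThan)

lemma lp_form_scale: "lp_form p U (\<lambda>j. c * y j) = \<bar>c\<bar> powr p * lp_form p U y"
proof -
  have "row_form U i (\<lambda>j. c * y j) = c * row_form U i y" for i
    by (simp add: row_form_def sum_distrib_left mult_ac)
  then show ?thesis by (simp add: lp_form_def abs_mult powr_mult sum_distrib_left)
qed

lemma abs_add_powr_le:
  fixes a b p :: real
  assumes "0 \<le> p" "p \<le> 2"
  shows "\<bar>a + b\<bar> powr p \<le> 4 * (\<bar>a\<bar> powr p + \<bar>b\<bar> powr p)"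
proof -
  have "\<bar>a + b\<bar> powr p \<le> (2 * max \<bar>a\<bar> \<bar>b\<bar>) powr p"
    using assms by (intro powr_mono2) auto
  also have "\<dots> = 2 powr p * max \<bar>a\<bar> \<bar>b\<bar> powr p"
    by (simp add: powr_mult)
  also have "\<dots> \<le> 2 powr 2 * (\<bar>a\<bar> powr p + \<bar>b\<bar> powr p)"
    using assms by (intro mult_mono powr_mono) (auto simp: max_def)
  finally show ?thesis by simp
qed

lemma lp_form_add_le:
  assumes "0 \<le> p" "p \<le> 2"
  shows "lp_form p U (\<lambda>j. x j + y j) \<le> 4 * (lp_form p U x + lp_form p U y)"
proof -
  have "row_form U i (\<lambda>j. x j + y j) = row_form U i x + row_form U i y" for i
    by (simp add: row_form_def sum.distrib distrib_left)
  then have "lp_form p U (\<lambda>j. x j + y j) = (\<Sum>i<dim_row U. \<bar>row_form U i x + row_form U i y\<bar> powr p)"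
    by (simp add: lp_form_def)
  also have "\<dots> \<le> (\<Sum>i<dim_row U. 4 * (\<bar>row_form U i x\<bar> powr p + \<bar>row_form U i y\<bar> powr p))"
    by (intro sum_mono abs_add_powr_le assms)
  finally show ?thesis by (simp add: lp_form_def sum.distrib flip: sum_distrib_left)
qed

lemma lp_form_le_energy:
  assumes "0 \<le> p"
  shows "lp_form p U y \<le> energy p U * (\<Sum>j<dim_col U. (y j)\<^sup>2) powr (p / 2)"
proof -
  have "\<bar>row_form U i y\<bar> powr p \<le> row_sq U i powr (p / 2) * (\<Sum>j<dim_col U. (y j)\<^sup>2) powr (p / 2)" for i
  proof -
    have "\<bar>row_form U i y\<bar> powr p = (row_form U i y)\<^sup>2 powr (p / 2)"
      by (rule power2_powr_half[symmetric])
    also have "\<dots> \<le> (row_sq U i * (\<Sum>j<dim_col U. (y j)\<^sup>2)) powr (p / 2)"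
      using assms by (intro powr_mono2 row_form_sq_le) auto
    finally show ?thesis by (simp add: powr_mult sum_nonneg)
  qed
  then show ?thesis by (simp add: lp_form_def energy_def sum_distrib_right sum_mono)
qed

text \<open>Rounding \<open>x\<close> to the lattice \<open>\<eta> \<int>\<^sup>d\<close> changes both forms only slightly, because the energies
  control them by the Euclidean norm of the rounding error.\<close>

lemma lp_form_lower_bound_from_net:
  assumes p: "1 \<le> p" "p \<le> 2" and U: "U \<in> carrier_mat n d" and Z: "Z \<in> carrier_mat s d"
    and EU: "energy p U \<le> real d" and EZ: "energy p Z \<le> real s * T"
    and cond: "\<And>y. (\<Sum>j<d. (y j)\<^sup>2) powr (p / 2) \<le> 6 * lp_form p U y"
    and net: "\<And>z. (\<And>j. j < d \<Longrightarrow> \<bar>z j\<bar> \<le> m) \<Longrightarrow>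
      \<kappa> * real s * lp_form p U (\<lambda>j. \<eta> * of_int (z j)) \<le> lp_form p Z (\<lambda>j. \<eta> * of_int (z j))"
    and \<eta>: "0 < \<eta>" and m: "6 / \<eta> + 1 \<le> of_int m" and \<kappa>: "0 < \<kappa>"
    and small: "real d * (real d * \<eta>\<^sup>2) powr (p / 2) \<le> 1 / 8"
      "T * (real d * \<eta>\<^sup>2) powr (p / 2) \<le> \<kappa> / 64"
  shows "\<kappa> / 64 * real s * lp_form p U x \<le> lp_form p Z x"
proof -
  let ?\<theta> = "(real d * \<eta>\<^sup>2) powr (p / 2)"
  have unit: "\<kappa> / 64 * real s \<le> lp_form p Z x" if x: "lp_form p U x = 1" for x
  proof -
    define z where "z j = \<lfloor>x j / \<eta>\<rfloor>" for j
    define y where "y j = \<eta> * of_int (z j)" for j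
    have err: "0 \<le> x j - y j" "x j - y j \<le> \<eta>" for j
    proof -
      have "\<eta> * of_int (z j) \<le> \<eta> * (x j / \<eta>)" "\<eta> * (x j / \<eta>) \<le> \<eta> * (of_int (z j) + 1)"
        using \<eta> by (intro mult_left_mono; auto simp: z_def less_imp_le)+
      then show "0 \<le> x j - y j" "x j - y j \<le> \<eta>"
        using \<eta> by (auto simp: y_def algebra_simps)
    qed
    have errs: "(\<Sum>j<d. (y j - x j)\<^sup>2) powr (p / 2) \<le> ?\<theta>" "(\<Sum>j<d. (x j - y j)\<^sup>2) powr (p / 2) \<le> ?\<theta>"
    proof -
      have "(\<Sum>j<d. (x j - y j)\<^sup>2) \<le> (\<Sum>j<d. \<eta>\<^sup>2)"
        using err by (intro sum_mono power_mono) auto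
      then show 1: "(\<Sum>j<d. (x j - y j)\<^sup>2) powr (p / 2) \<le> ?\<theta>"
        using p by (intro powr_mono2) (auto intro: sum_nonneg)
      show "(\<Sum>j<d. (y j - x j)\<^sup>2) powr (p / 2) \<le> ?\<theta>"
        using 1 by (simp add: power2_commute)
    qed
    have "\<bar>z j\<bar> \<le> m" if j: "j < d" for j
    proof -
      have "(x j)\<^sup>2 \<le> (\<Sum>j<d. (x j)\<^sup>2)" using j by (intro member_le_sum) auto
      then have "(x j)\<^sup>2 powr (p / 2) \<le> (\<Sum>j<d. (x j)\<^sup>2) powr (p / 2)"
        using p by (intro powr_mono2) auto
      also have "\<dots> \<le> 6" using cond[of x] x by simp
      finally have "\<bar>x j\<bar> powr p \<le> 6" by (simp add: power2_powr_half)
      \<comment> \<open>Here \<open>p \<ge> 1\<close> enters: a number above 6 has its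
        \<open>p\<close>-th power above 6. Dividing by \<open>\<eta>\<close> and allowing 1 for the
        floor keeps the rounded point inside the box of the net.\<close>
      have x6: "\<bar>x j\<bar> \<le> 6"
      proof (rule ccontr)
        assume "\<not> \<bar>x j\<bar> \<le> 6"
        then have "\<bar>x j\<bar> powr 1 \<le> \<bar>x j\<bar> powr p" using p by (intro powr_mono) auto
        with \<open>\<bar>x j\<bar> powr p \<le> 6\<close> \<open>\<not> \<bar>x j\<bar> \<le> 6\<close> show False by simp
      qed
      have "\<bar>x j / \<eta>\<bar> \<le> 6 / \<eta>" using x6 \<eta> by (simp add: divide_right_mono)
      then have "\<bar>of_int (z j) :: real\<bar> \<le> 6 / \<eta> + 1" unfolding z_def by linarith
      then have "of_int \<bar>z j\<bar> \<le> (of_int m :: real)" using m by simp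
      then show ?thesis by (simp only: of_int_le_iff)
    qed
    from net[OF this] have netz: "\<kappa> * real s * lp_form p U y \<le> lp_form p Z y"
      by (simp add: y_def[abs_def])
    have "lp_form p U (\<lambda>j. x j - y j) \<le> real d * ?\<theta>"
      using U p errs EU
      by (intro order_trans[OF lp_form_le_energy mult_mono]) (auto simp: energy_def sum_nonneg)
    then have "lp_form p U (\<lambda>j. x j - y j) \<le> 1 / 8" using small(1) by (rule order_trans)
    moreover have "1 \<le> 4 * (lp_form p U y + lp_form p U (\<lambda>j. x j - y j))"
      using lp_form_add_le[of p U y "\<lambda>j. x j - y j"] p x by simp
    ultimately have "1 / 8 \<le> lp_form p U y" by argo
    then have "\<kappa> * real s * (1 / 8) \<le> \<kappa> * real s * lp_form p U y"
      using \<kappa> by (intro mult_left_mono) auto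
    with netz have low: "\<kappa> * real s / 8 \<le> lp_form p Z y" by linarith
    have "lp_form p Z (\<lambda>j. y j - x j) \<le> real s * T * ?\<theta>"
    proof (rule order_trans[OF lp_form_le_energy mult_mono])
      have "0 \<le> energy p Z" by (simp add: energy_def sum_nonneg)
      then show "0 \<le> real s * T" using EZ by linarith
    qed (use Z p errs EZ in auto)
    also have "\<dots> \<le> real s * (\<kappa> / 64)"
      using small(2) by (simp only: mult.assoc) (intro mult_left_mono, auto)
    finally have "lp_form p Z (\<lambda>j. y j - x j) \<le> real s * \<kappa> / 64" by simp
    \<comment> \<open>The result is \<open>\<kappa> * s / 8 \<le> 4 * (lp_form p Z x + \<kappa> * s
      / 64)\<close>, so \<open>\<kappa> * s / 32 - \<kappa> * s / 64\<close> remains as a lower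
      bound at \<open>x\<close>.\<close>
    moreover have "lp_form p Z y \<le> 4 * (lp_form p Z x + lp_form p Z (\<lambda>j. y j - x j))"
      using lp_form_add_le[of p Z x "\<lambda>j. y j - x j"] p by simp
    ultimately show ?thesis using low by (simp add: mult.commute)
  qed
  show ?thesis
  proof (cases "lp_form p U x = 0")
    case False
    define r where "r = lp_form p U x powr (- (1 / p))"
    have pos: "0 < lp_form p U x" using False lp_form_nonneg[of p U x] by linarith
    then have r: "0 < r" by (simp add: r_def)
    have "r powr p = lp_form p U x powr (- 1)" using p by (simp add: r_def powr_powr)
    then have rp: "r powr p = 1 / lp_form p U x" using pos by (simp add: powr_minus_divide)
    have "lp_form p U (\<lambda>j. r * x j) = 1"
      using pos r by (simp add: lp_form_scale rp)
    from unit[OF this] have "\<kappa> / 64 * real s \<le> lp_form p Z x / lp_form p U x"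
      using r by (simp add: lp_form_scale rp)
    then show ?thesis using pos by (simp add: field_simps)
  qed simp
qed

section \<open>The sketched matrix and its two bad events\<close>

lemma row_form_mat_mult:
  assumes U: "U \<in> carrier_mat n d" and k: "k < s"
  shows "row_form (mat s n g * U) k y = (\<Sum>i<n. g (k, i) * row_form U i y)"
proof -
  have "row_form (mat s n g * U) k y = (\<Sum>j<d. (\<Sum>i<n. g (k, i) * U $$ (i, j)) * y j)"
    using U k by (simp add: row_form_def scalar_prod_def atLeast0LessThan)
  also have "\<dots> = (\<Sum>j<d. \<Sum>i<n. g (k, i) * (U $$ (i, j) * y j))"
    by (simp add: sum_distrib_right mult.assoc)
  also have "\<dots> = (\<Sum>i<n. g (k, i) * row_form U i y)"
    using U by (subst sum.swap) (simp add: row_form_def sum_distrib_left)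
  finally show ?thesis .
qed

lemma lp_form_mat_mult:
  assumes "U \<in> carrier_mat n d"
  shows "lp_form p (mat s n g * U) y = (\<Sum>k<s. \<bar>\<Sum>i<n. g (k, i) * row_form U i y\<bar> powr p)"
  using assms by (simp add: lp_form_def row_form_mat_mult)

lemma row_sq_mat_mult:
  assumes "U \<in> carrier_mat n d" "k < s"
  shows "row_sq (mat s n g * U) k = (\<Sum>j<d. (\<Sum>i<n. g (k, i) * U $$ (i, j))\<^sup>2)"
  using assms by (simp add: row_sq_def scalar_prod_def atLeast0LessThan)

text \<open>Each row of the sketched matrix is a stable vector built from the rows of
  \<open>U\<close>, so its norm has a weak tail governed by \<open>energy p U \<le> d\<close>. The
  \<open>+ 1\<close> in \<open>C\<close> ensures \<open>1 \<le> C\<close>, which the summation over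
  the rows requires.\<close>

lemma energy_sketch_bound:
  assumes D: "standard_stable p D" and p: "0 < p" "p \<le> 2"
    and U: "U \<in> carrier_mat n d" and EU: "energy p U \<le> real d"
    and d: "0 < d" and s: "0 < s" and C: "C = 2 * gauss_moment p + 1" and L: "4 * C * s \<le> 2 ^ L"
  shows "\<P>(g in iid_entries D s n. real s * (real d * (1 + 8 * C * L)) < energy p (mat s n g * U)) \<le> 1 / 2"
proof -
  interpret D: real_distribution D using D by (rule standard_stable_real_distribution)
  let ?M = "iid_entries D s n"
  let ?W = "\<lambda>k g. (\<Sum>j<d. (\<Sum>i<n. g (k, i) * U $$ (i, j))\<^sup>2) powr (p / 2)"
  have meas: "?W k \<in> borel_measurable ?M" if "k < s" for k
    unfolding iid_entries_def by measurable (use that in auto)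
  have tail: "\<P>(g in ?M. \<tau> \<le> ?W k g) \<le> C * real d / \<tau>" if k: "k < s" and \<tau>: "0 < \<tau>" for k \<tau>
  proof -
    let ?row = "\<lambda>g. \<lambda>i\<in>{..<n}. g (k, i)" and ?P = "Pi\<^sub>M {..<n} (\<lambda>_. D)"
    have row: "?row \<in> measurable ?M ?P"
      unfolding iid_entries_def using k by (intro measurable_restrict measurable_component_singleton) auto
    let ?E = "{x \<in> space ?P. \<tau> \<le> (\<Sum>j<d. (\<Sum>i<n. x i * U $$ (i, j))\<^sup>2) powr (p / 2)}"
    have E: "?E \<in> sets ?P" by measurable
    have "\<P>(g in ?M. \<tau> \<le> ?W k g) = measure ?M (?row -` ?E \<inter> space ?M)"
      using measurable_space[OF row] by (intro arg_cong[where f = "measure ?M"]) auto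
    also have "\<dots> = measure (distr ?M ?P ?row) ?E"
      by (rule measure_distr[OF row E, symmetric])
    also have "\<dots> = measure ?P ?E" unfolding distr_iid_entries_row[OF D k] ..
    also have "\<dots> \<le> 2 * gauss_moment p / \<tau> * (\<Sum>i<n. (\<Sum>j<d. (U $$ (i, j))\<^sup>2) powr (p / 2))"
      by (rule stable_vector_tail[OF D p _ _ \<tau>]) auto
    also have "(\<Sum>i<n. (\<Sum>j<d. (U $$ (i, j))\<^sup>2) powr (p / 2)) = energy p U"
      using U by (simp add: energy_def row_sq_def)
    also have "2 * gauss_moment p / \<tau> * energy p U \<le> C / \<tau> * real d"
      using EU \<tau> gauss_moment_nonneg[of p]
      by (intro mult_mono divide_right_mono) (auto simp: C energy_def sum_nonneg)
    finally show ?thesis by simp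
  qed
  have "\<P>(g in ?M. real s * real d * (1 + 8 * C * L) < (\<Sum>k<s. ?W k g)) \<le> 1 / 2"
    using d s L gauss_moment_nonneg[of p]
    by (intro weak_type_sum_bound[OF prob_space_iid_entries[OF D] meas tail]) (auto simp: C)
  also have "(\<lambda>g. \<Sum>k<s. ?W k g) = (\<lambda>g. energy p (mat s n g * U))"
    using U by (simp add: energy_def row_sq_mat_mult fun_eq_iff)
  finally show ?thesis by (simp add: mult.assoc)
qed

text \<open>A union bound over the \<open>(2 * m + 1) ^ d\<close> integer points of a box, with the
  exponential lower tail at each of them. The multiplier \<open>\<eta>\<close> may be arbitrary
  here, since the lower tail is scale invariant.\<close>

lemma net_lower_bound:
  assumes D: "standard_stable p D" and p: "0 < p" and pos: "0 < s" "0 < n"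
    and U: "U \<in> carrier_mat n d" and m: "0 \<le> m"
  defines "\<kappa> \<equiv> - ln (laplace p D) / 2"
  shows "\<P>(g in iid_entries D s n. \<exists>z. (\<forall>j<d. \<bar>z j\<bar> \<le> m) \<and>
      lp_form p (mat s n g * U) (\<lambda>j. \<eta> * of_int (z j)) < \<kappa> * real s * lp_form p U (\<lambda>j. \<eta> * of_int (z j)))
    \<le> (2 * of_int m + 1) ^ d * exp (- (\<kappa> * s))"
    and "{g \<in> space (iid_entries D s n). \<exists>z. (\<forall>j<d. \<bar>z j\<bar> \<le> m) \<and>
      lp_form p (mat s n g * U) (\<lambda>j. \<eta> * of_int (z j)) < \<kappa> * real s * lp_form p U (\<lambda>j. \<eta> * of_int (z j))}
      \<in> sets (iid_entries D s n)"
proof -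
  interpret D: real_distribution D using D by (rule standard_stable_real_distribution)
  let ?M = "iid_entries D s n"
  interpret M: prob_space ?M using D by (rule prob_space_iid_entries)
  let ?y = "\<lambda>z j. \<eta> * real_of_int (z j)"
  let ?N = "PiE {..<d} (\<lambda>_. {- m..m})"
  let ?B = "\<lambda>z. {g \<in> space ?M. lp_form p (mat s n g * U) (?y z) < \<kappa> * real s * lp_form p U (?y z)}"
  have fin: "finite ?N" by (intro finite_PiE) auto
  have meas: "(\<lambda>g. lp_form p (mat s n g * U) y) \<in> borel_measurable ?M" for y
    unfolding lp_form_mat_mult[OF U] iid_entries_def by measurable
  have B: "?B z \<in> sets ?M" for z using meas by measurable
  have bound: "measure ?M (?B z) \<le> exp (- (\<kappa> * s))" for z
  proof (cases "lp_form p U (?y z) = 0")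
    \<comment> \<open>The strict inequality in the bad event makes failure impossible where the form
      vanishes; elsewhere the form is positive and the lower tail applies.\<close>
    case True
    then have "?B z = {}" by (auto simp: not_less)
    then show ?thesis by (simp only: measure_empty exp_ge_zero)
  next
    case False
    have eq: "lp_form p U (?y z) = (\<Sum>i<n. \<bar>row_form U i (?y z)\<bar> powr p)"
      using U by (simp add: lp_form_def)
    have V: "0 < (\<Sum>i<n. \<bar>row_form U i (?y z)\<bar> powr p)"
      using False lp_form_nonneg[of p U "?y z"] unfolding eq by linarith
    have "measure ?M (?B z) \<le> \<P>(g in ?M. (\<Sum>k<s. \<bar>\<Sum>i<n. g (k, i) * row_form U i (?y z)\<bar> powr p)
        \<le> \<kappa> * s * (\<Sum>i<n. \<bar>row_form U i (?y z)\<bar> powr p))"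
    proof (rule M.finite_measure_mono)
      have "(\<lambda>g. \<Sum>k<s. \<bar>\<Sum>i<n. g (k, i) * row_form U i (?y z)\<bar> powr p) \<in> borel_measurable ?M"
        using meas[of "?y z"] unfolding lp_form_mat_mult[OF U] .
      then show "{g \<in> space ?M. (\<Sum>k<s. \<bar>\<Sum>i<n. g (k, i) * row_form U i (?y z)\<bar> powr p)
        \<le> \<kappa> * s * (\<Sum>i<n. \<bar>row_form U i (?y z)\<bar> powr p)} \<in> sets ?M"
        by measurable
    qed (auto simp: lp_form_mat_mult[OF U] eq)
    also have "\<dots> \<le> exp (- (\<kappa> * s))"
      unfolding \<kappa>_def by (rule stable_anticoncentration[OF D p pos V])
    finally show ?thesis .
  qed
  \<comment> \<open>Only the values of \<open>z\<close> below \<open>d\<close> matter, so the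
    quantifier over all functions reduces to the finite set \<open>?N\<close>.\<close>
  have restr: "lp_form p W (?y (restrict z {..<d})) = lp_form p W (?y z)" if "dim_col W = d" for z W
    using that by (simp add: lp_form_def row_form_def)
  have union: "{g \<in> space ?M. \<exists>z. (\<forall>j<d. \<bar>z j\<bar> \<le> m) \<and>
      lp_form p (mat s n g * U) (?y z) < \<kappa> * real s * lp_form p U (?y z)} = (\<Union>z\<in>?N. ?B z)"
  proof (intro equalityI subsetI)
    fix g assume "g \<in> {g \<in> space ?M. \<exists>z. (\<forall>j<d. \<bar>z j\<bar> \<le> m) \<and>
      lp_form p (mat s n g * U) (?y z) < \<kappa> * real s * lp_form p U (?y z)}"
    then obtain z where g: "g \<in> space ?M" and z: "\<forall>j<d. \<bar>z j\<bar> \<le> m"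
      and less: "lp_form p (mat s n g * U) (?y z) < \<kappa> * real s * lp_form p U (?y z)" by auto
    have "restrict z {..<d} \<in> ?N" using z by (auto simp: abs_le_iff)
    moreover have "g \<in> ?B (restrict z {..<d})"
      using g less U by (simp only: mem_Collect_eq restr carrier_matD index_mult_mat)
    ultimately show "g \<in> (\<Union>z\<in>?N. ?B z)" by blast
  next
    fix g assume "g \<in> (\<Union>z\<in>?N. ?B z)"
    then obtain z where z: "z \<in> ?N" "g \<in> ?B z" by blast
    then have "\<forall>j<d. \<bar>z j\<bar> \<le> m" by (auto simp: PiE_iff abs_le_iff minus_le_iff)
    with z(2) show "g \<in> {g \<in> space ?M. \<exists>z. (\<forall>j<d. \<bar>z j\<bar> \<le> m) \<and>
      lp_form p (mat s n g * U) (?y z) < \<kappa> * real s * lp_form p U (?y z)}" by blast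
  qed
  show "{g \<in> space ?M. \<exists>z. (\<forall>j<d. \<bar>z j\<bar> \<le> m) \<and>
      lp_form p (mat s n g * U) (?y z) < \<kappa> * real s * lp_form p U (?y z)} \<in> sets ?M"
    unfolding union using fin B by auto
  have "measure ?M (\<Union>z\<in>?N. ?B z) \<le> (\<Sum>z\<in>?N. measure ?M (?B z))"
    using B by (intro M.finite_measure_subadditive_finite fin) auto
  also have "\<dots> \<le> (\<Sum>z\<in>?N. exp (- (\<kappa> * s)))" by (intro sum_mono bound)
  also have "\<dots> = real (card ?N) * exp (- (\<kappa> * s))" by simp
  also have "real (card ?N) = (2 * of_int m + 1) ^ d"
    using m by (simp add: card_PiE)
  finally show "\<P>(g in ?M. \<exists>z. (\<forall>j<d. \<bar>z j\<bar> \<le> m) \<and>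
      lp_form p (mat s n g * U) (?y z) < \<kappa> * real s * lp_form p U (?y z)) \<le> (2 * of_int m + 1) ^ d * exp (- (\<kappa> * s))"
    unfolding union .
qed

subsection \<open>Measurability and the choice of parameters\<close>

lemma tendsto_lp_form:
  assumes "0 < p" and "\<And>j. j < dim_col U \<Longrightarrow> (\<lambda>m. Y m j) \<longlonglongrightarrow> y j"
  shows "(\<lambda>m. lp_form p U (Y m)) \<longlonglongrightarrow> lp_form p U y"
  unfolding lp_form_def row_form_def using assms
  by (intro tendsto_sum tendsto_powr2 tendsto_rabs tendsto_mult tendsto_const) auto

lemma lp_form_cong:
  "(\<And>j. j < dim_col U \<Longrightarrow> x j = y j) \<Longrightarrow> lp_form p U x = lp_form p U y"
  by (simp add: lp_form_def row_form_def)

text \<open>The event is an uncountable intersection over \<open>x\<close>. For fixed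
  \<open>g\<close> both norms are continuous in \<open>x\<close> and the inequalities are closed, so
  rational vectors suffice and the intersection becomes countable.\<close>

lemma distortion_event_measurable:
  assumes D: "standard_stable p D" and p: "0 < p" and A: "A \<in> carrier_mat n d"
  shows "{g \<in> space (iid_entries D s n). \<forall>x\<in>carrier_vec d.
      a * lp_norm p (A *\<^sub>v x) \<le> b * lp_norm p (mat s n g * A *\<^sub>v x) \<and>
      b * lp_norm p (mat s n g * A *\<^sub>v x) \<le> c * lp_norm p (A *\<^sub>v x)} \<in> sets (iid_entries D s n)"
proof -
  interpret D: real_distribution D using D by (rule standard_stable_real_distribution)
  let ?M = "iid_entries D s n"
  let ?P = "\<lambda>g y. a * lp_form p A y powr (1 / p) \<le> b * lp_form p (mat s n g * A) y powr (1 / p) \<and>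
      b * lp_form p (mat s n g * A) y powr (1 / p) \<le> c * lp_form p A y powr (1 / p)"
  \<comment> \<open>Lists of rationals form a countable type, unlike functions on the naturals. A
    list of the wrong length is harmless, since \<open>?q r\<close> is still some real
    vector.\<close>
  let ?q = "\<lambda>(r :: rat list) j. real_of_rat (r ! j)"
  have meas: "(\<lambda>g. lp_form p (mat s n g * A) y) \<in> borel_measurable ?M" for y
    unfolding lp_form_mat_mult[OF A] iid_entries_def by measurable
  have "(\<forall>x\<in>carrier_vec d.
      a * lp_norm p (A *\<^sub>v x) \<le> b * lp_norm p (mat s n g * A *\<^sub>v x) \<and>
      b * lp_norm p (mat s n g * A *\<^sub>v x) \<le> c * lp_norm p (A *\<^sub>v x)) \<longleftrightarrow> (\<forall>r. ?P g (?q r))" for g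
  proof -
    let ?Z = "mat s n g * A"
    have Z: "?Z \<in> carrier_mat s d" by (rule mult_carrier_mat[OF mat_carrier A])
    have "?P g y" if "\<forall>r. ?P g (?q r)" for y
    proof -
      define Y where "Y m = ?q (map (\<lambda>j. of_int \<lfloor>real m * y j\<rfloor> / of_nat m) [0..<d])" for m
      have Yj: "Y m j = of_int \<lfloor>real m * y j\<rfloor> / real m" if "j < d" for m j
        using that by (simp add: Y_def of_rat_divide)
      have lim: "(\<lambda>m. Y m j) \<longlonglongrightarrow> y j" if "j < d" for j
      proof -
        have "(\<lambda>m. Y m j - y j) \<longlonglongrightarrow> 0"
        proof (rule Lim_null_comparison[OF _ lim_1_over_n])
          show "\<forall>\<^sub>F m in sequentially. norm (Y m j - y j) \<le> 1 / real m"
            using eventually_gt_at_top[of 0]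
          proof eventually_elim
            case (elim m)
            have "\<bar>of_int \<lfloor>real m * y j\<rfloor> - real m * y j\<bar> \<le> 1" by linarith
            then have "\<bar>of_int \<lfloor>real m * y j\<rfloor> - real m * y j\<bar> / real m \<le> 1 / real m"
              using elim by (simp add: divide_right_mono)
            also have "\<bar>of_int \<lfloor>real m * y j\<rfloor> - real m * y j\<bar> / real m
                = \<bar>(of_int \<lfloor>real m * y j\<rfloor> - real m * y j) / real m\<bar>"
              by simp
            also have "(of_int \<lfloor>real m * y j\<rfloor> - real m * y j) / real m = Y m j - y j"
              using elim that by (simp add: Yj diff_divide_distrib)
            finally show ?case by simp
          qed
        qed
        then show ?thesis by (simp add: LIM_zero_iff)
      qed
      have lims: "(\<lambda>m. lp_form p A (Y m) powr (1 / p)) \<longlonglongrightarrow> lp_form p A y powr (1 / p)"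
        "(\<lambda>m. lp_form p ?Z (Y m) powr (1 / p)) \<longlonglongrightarrow> lp_form p ?Z y powr (1 / p)"
      proof -
        have "(\<lambda>m. lp_form p W (Y m) powr (1 / p)) \<longlonglongrightarrow> lp_form p W y powr (1 / p)" if "dim_col W = d" for W
          using p that
          by (intro tendsto_powr2[OF tendsto_lp_form[OF p] tendsto_const]) (simp_all add: lim)
        from this[of A] this[of ?Z] carrier_matD(2)[OF A] carrier_matD(2)[OF Z]
        show "(\<lambda>m. lp_form p A (Y m) powr (1 / p)) \<longlonglongrightarrow> lp_form p A y powr (1 / p)"
          "(\<lambda>m. lp_form p ?Z (Y m) powr (1 / p)) \<longlonglongrightarrow> lp_form p ?Z y powr (1 / p)"
          by blast+
      qed
      have PY: "?P g (Y m)" for m using that unfolding Y_def by blast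
      show ?thesis
      proof
        show "a * lp_form p A y powr (1 / p) \<le> b * lp_form p ?Z y powr (1 / p)"
          by (rule LIMSEQ_le[OF tendsto_mult[OF tendsto_const lims(1)] tendsto_mult[OF tendsto_const lims(2)]])
             (intro exI[of _ 0] allI impI PY[THEN conjunct1])
        show "b * lp_form p ?Z y powr (1 / p) \<le> c * lp_form p A y powr (1 / p)"
          by (rule LIMSEQ_le[OF tendsto_mult[OF tendsto_const lims(2)] tendsto_mult[OF tendsto_const lims(1)]])
             (intro exI[of _ 0] allI impI PY[THEN conjunct2])
      qed
    qed
    moreover have "?P g (?q r)" if *: "\<forall>x\<in>carrier_vec d. ?P g (vec_index x)" for r
    proof -
      have "lp_form p W (vec_index (Matrix.vec d (?q r))) = lp_form p W (?q r)" if "dim_col W = d" for W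
        using that by (intro lp_form_cong) simp
      then show ?thesis
        using bspec[OF *, of "Matrix.vec d (?q r)"] A Z by simp
    qed
    moreover have "(\<forall>x\<in>carrier_vec d.
      a * lp_norm p (A *\<^sub>v x) \<le> b * lp_norm p (?Z *\<^sub>v x) \<and>
      b * lp_norm p (?Z *\<^sub>v x) \<le> c * lp_norm p (A *\<^sub>v x)) \<longleftrightarrow> (\<forall>x\<in>carrier_vec d. ?P g (vec_index x))"
      by (intro ball_cong refl) (simp only: lp_norm_mult_vec[OF A] lp_norm_mult_vec[OF Z])
    ultimately show ?thesis by blast
  qed
  then have "{g \<in> space ?M. \<forall>x\<in>carrier_vec d.
      a * lp_norm p (A *\<^sub>v x) \<le> b * lp_norm p (mat s n g * A *\<^sub>v x) \<and>
      b * lp_norm p (mat s n g * A *\<^sub>v x) \<le> c * lp_norm p (A *\<^sub>v x)} = {g \<in> space ?M. \<forall>r. ?P g (?q r)}"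
    by (simp only:)
  moreover have "{g \<in> space ?M. ?P g (?q r)} \<in> sets ?M" for r
    using meas[of "?q r"] by measurable
  then have "{g \<in> space ?M. \<forall>r. ?P g (?q r)} \<in> sets ?M"
    by (rule sets.sets_Collect_countable_All)
  ultimately show ?thesis by (simp only:)
qed

text \<open>This makes precise how large \<open>\<omega>\<close> has to be. The square root trick
  \<open>ln y = 2 * ln (sqrt y) \<le> 2 * sqrt y\<close> and the first part of the threshold bound
  the logarithmic term by \<open>\<kappa> * \<omega> / 2\<close>; the part
  \<open>10 / \<kappa>\<close> lets the other half absorb the 5.\<close>

lemma log_le_linear:
  fixes C \<kappa> :: real
  assumes "0 < C" "0 < \<kappa>"
  shows "\<exists>\<omega>\<^sub>0\<ge>1. \<forall>\<omega>\<ge>\<omega>\<^sub>0. 2 * ln (C * \<omega>) + 5 \<le> \<kappa> * \<omega>"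
proof (intro exI[of _ "max 1 (64 * C / \<kappa>\<^sup>2 + 10 / \<kappa>)"] conjI allI impI)
  fix \<omega> assume \<omega>: "max 1 (64 * C / \<kappa>\<^sup>2 + 10 / \<kappa>) \<le> \<omega>"
  have "0 \<le> 64 * C / \<kappa>\<^sup>2" "0 \<le> 10 / \<kappa>" using assms by auto
  moreover have "64 * C / \<kappa>\<^sup>2 + 10 / \<kappa> \<le> \<omega>" and \<omega>1: "1 \<le> \<omega>" using \<omega> by simp_all
  ultimately have "64 * C / \<kappa>\<^sup>2 \<le> \<omega>" "10 / \<kappa> \<le> \<omega>" by linarith+
  then have 1: "64 * C \<le> \<kappa>\<^sup>2 * \<omega>" and 2: "10 \<le> \<kappa> * \<omega>"
    using assms by (simp_all add: field_simps)
  have "64 * C * \<omega> \<le> \<kappa>\<^sup>2 * \<omega> * \<omega>" using 1 \<omega>1 by (intro mult_right_mono) auto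
  then have "C * \<omega> \<le> (\<kappa> * \<omega> / 8)\<^sup>2" by (simp add: power2_eq_square field_simps)
  then have sq: "sqrt (C * \<omega>) \<le> \<kappa> * \<omega> / 8" using assms \<omega>1 by (intro real_le_lsqrt) auto
  have pos: "0 < sqrt (C * \<omega>)" using assms \<omega>1 by simp
  have "ln (C * \<omega>) = 2 * ln (sqrt (C * \<omega>))" using assms \<omega>1 by (simp add: ln_sqrt)
  also have "\<dots> \<le> 2 * sqrt (C * \<omega>)" using ln_le_minus_one[OF pos] by simp
  finally show "2 * ln (C * \<omega>) + 5 \<le> \<kappa> * \<omega>" using sq 2 by linarith
qed simp

text \<open>The choices depend on each other in a chain: \<open>s\<close> fixes the number
  \<open>L\<close> of dyadic levels, \<open>L\<close> the dilation bound, the dilation bound the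
  mesh \<open>\<eta>\<close>, and \<open>\<eta>\<close> the size of the net, which
  \<open>exp (- (\<kappa> * s))\<close> has to beat. The chain closes because the mesh enters the
  exponent only logarithmically. For \<open>d \<ge> 2\<close> the logarithm is at least
  \<open>1 / 2\<close>, which lets additive constants be absorbed.\<close>

lemma sketch_parameters:
  fixes \<kappa> C \<omega> p :: real and d s :: nat
  assumes \<kappa>: "0 < \<kappa>" and C: "1 \<le> C" and p: "1 \<le> p" and d: "2 \<le> d" and \<omega>: "1 \<le> \<omega>"
    and large: "2 * ln (773 * 306 * C\<^sup>2 / min \<kappa> 1 * \<omega>) + 5 \<le> \<kappa> * \<omega>"
    and s: "s = nat \<lceil>\<omega> * real d * ln (real d)\<rceil>"
  shows "0 < s" and "real s \<le> 2 * \<omega> * (real d * ln (real d))" and "1 \<le> real d * ln (real d)"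
    and "\<exists>L m \<eta>. 4 * C * s \<le> 2 ^ L \<and> 0 < \<eta> \<and> 6 / \<eta> + 1 \<le> real_of_int m \<and> 0 \<le> m \<and>
      d * (1 + 8 * C * L) \<le> 306 * C\<^sup>2 * \<omega> * (real d * ln (real d)) \<and>
      real d * (real d * \<eta>\<^sup>2) powr (p / 2) \<le> 1 / 8 \<and>
      d * (1 + 8 * C * L) * (real d * \<eta>\<^sup>2) powr (p / 2) \<le> \<kappa> / 64 \<and>
      (2 * real_of_int m + 1) ^ d * exp (- (\<kappa> * s)) \<le> 1 / 4"
proof -
  define l where "l = ln (real d)"
  have "ln 2 \<le> l" unfolding l_def using d by simp
  then have l: "1 / 2 \<le> l" using ln2_ge_two_thirds by linarith
  have ld: "l \<le> real d" unfolding l_def using d ln_le_minus_one[of "real d"] by simp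
  have "2 * (1 / 2) \<le> real d * l" using d l by (intro mult_mono) auto
  then have dl: "1 \<le> real d * l" by simp
  then show "1 \<le> real d * ln (real d)" by (simp add: l_def)
  have "1 * 1 \<le> \<omega> * (real d * l)" using \<omega> dl by (intro mult_mono) auto
  then have odl: "1 \<le> \<omega> * real d * l" by (simp add: mult.assoc)
  have s_ge: "\<omega> * real d * l \<le> s" unfolding s l_def by linarith
  have "real s \<le> \<omega> * real d * l + 1" unfolding s l_def[symmetric] using odl by linarith
  then have s_le: "real s \<le> 2 * \<omega> * (real d * l)" using odl by (simp add: mult.assoc)
  then show "real s \<le> 2 * \<omega> * (real d * ln (real d))" by (simp add: l_def)
  show s0: "0 < s" using s_ge odl by (cases s) auto
  have C\<omega>: "1 \<le> C * \<omega>" using mult_mono[OF C \<omega>] C by simp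
  define L where "L = nat \<lceil>log 2 (4 * C * s)\<rceil>"
  have "1 * 1 \<le> C * real s" using C s0 by (intro mult_mono) auto
  then have Cs: "1 \<le> 4 * C * s" by simp
  have "4 * C * s = 2 powr log 2 (4 * C * s)" using Cs by simp
  also have "\<dots> \<le> 2 powr real L" unfolding L_def by (intro powr_mono real_nat_ceiling_ge) auto
  finally have L_ge: "4 * C * s \<le> 2 ^ L" by (simp add: powr_realpow)
  have "0 \<le> log 2 (4 * C * s)" using Cs by simp
  then have "real L \<le> log 2 (4 * C * s) + 1" unfolding L_def by linarith
  also have "log 2 (4 * C * s) \<le> ln (4 * C * s) / (1 / 2)"
    unfolding log_def using Cs ln2_ge_two_thirds by (intro divide_left_mono) auto
  also have "ln (4 * C * s) \<le> ln (8 * (C * \<omega>) * (real d)\<^sup>2)"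
  proof (subst ln_le_cancel_iff)
    have "real s \<le> 2 * \<omega> * (real d * real d)"
      by (rule order_trans[OF s_le]) (use \<omega> ld in \<open>intro mult_left_mono, auto\<close>)
    then have "4 * C * real s \<le> 4 * C * (2 * \<omega> * (real d * real d))"
      using C by (intro mult_left_mono) auto
    then show "4 * C * real s \<le> 8 * (C * \<omega>) * (real d)\<^sup>2"
      by (simp add: power2_eq_square mult_ac)
    show "0 < 8 * (C * \<omega>) * (real d)\<^sup>2" using C\<omega> d by simp
  qed (use Cs in auto)
  also have "\<dots> = ln (8 * (C * \<omega>)) + 2 * l"
    using C\<omega> d by (subst ln_mult) (auto simp: l_def ln_realpow)
  also have "\<dots> \<le> 8 * (C * \<omega>) + 2 * l" using ln_le_minus_one[of "8 * (C * \<omega>)"] C\<omega> by simp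
  finally have "real L \<le> 16 * (C * \<omega>) + 4 * l + 1" by simp
  \<comment> \<open>With \<open>l \<ge> 1 / 2\<close> and \<open>C * \<omega> \<ge> 1\<close>, the
    three terms are at most 32, 4 and 2 times \<open>C * \<omega> * l\<close>, which gives
    38.\<close>
  moreover have "C * \<omega> * (1 / 2) \<le> C * \<omega> * l" using C\<omega> l by (intro mult_left_mono) auto
  moreover have "1 * l \<le> C * \<omega> * l" using C\<omega> l by (intro mult_right_mono) auto
  ultimately have L_le: "real L \<le> 38 * (C * \<omega> * l)" using C\<omega> by linarith
  \<comment> \<open>The constant is \<open>306 = 8 * 38 + 2\<close>, where the 2 absorbs the summand
    1 of the dilation bound.\<close>
  define C2 where "C2 = 306 * C\<^sup>2 * \<omega>"
  have "1 * 1 \<le> C * (C * \<omega>)" using C C\<omega> by (intro mult_mono) auto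
  then have C2_ge: "306 \<le> C2" by (simp add: C2_def power2_eq_square mult.assoc)
  have "8 * C * real L \<le> 8 * C * (38 * (C * \<omega> * l))" using L_le C by (intro mult_left_mono) auto
  moreover have "1 \<le> 2 * (C * (C * \<omega>) * l)"
  proof -
    have "1 * (1 / 2) \<le> C * (C * \<omega>) * l"
      using \<open>1 * 1 \<le> C * (C * \<omega>)\<close> l by (intro mult_mono) auto
    then show ?thesis by simp
  qed
  ultimately have "1 + 8 * C * L \<le> C2 * l"
    by (simp add: C2_def power2_eq_square mult_ac)
  then have "d * (1 + 8 * C * L) \<le> d * (C2 * l)" by (intro mult_left_mono) auto
  then have T: "d * (1 + 8 * C * L) \<le> C2 * (real d * l)" by (simp add: mult_ac)
  have "C2 * (real d * l) \<le> C2 * (real d * real d)"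
    using C2_ge ld by (intro mult_left_mono) auto
  with T have T2: "d * (1 + 8 * C * L) \<le> C2 * (real d)\<^sup>2" by (simp add: power2_eq_square)
  \<comment> \<open>The cap at 1 puts \<open>\<kappa>' / 64\<close> below both
    \<open>\<kappa> / 64\<close> and \<open>1 / 8\<close>, so that one mesh serves both rounding
    errors.\<close>
  define \<kappa>' where "\<kappa>' = min \<kappa> 1"
  have \<kappa>': "0 < \<kappa>'" "\<kappa>' \<le> 1" "\<kappa>' \<le> \<kappa>" using \<kappa> by (auto simp: \<kappa>'_def)
  \<comment> \<open>Two powers of \<open>d\<close> come from the dilation bound, where
    \<open>ln d \<le> d\<close>, and one from the Euclidean rounding error
    \<open>d * \<eta>\<close>; the product is then exactly \<open>\<kappa>' / 64\<close>.\<close>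
  define \<eta> where "\<eta> = \<kappa>' / (64 * C2 * real d ^ 3)"
  have \<eta>: "0 < \<eta>" using \<kappa>' C2_ge d by (simp add: \<eta>_def)
  have d\<eta>: "C2 * (real d)\<^sup>2 * (real d * \<eta>) = \<kappa>' / 64"
    using C2_ge d by (simp add: \<eta>_def power2_eq_square power3_eq_cube)
  have "1 * 1 \<le> C2 * real d" using C2_ge d by (intro mult_mono) auto
  then have "1 * 1 \<le> C2 * real d * real d" using d by (intro mult_mono) auto
  then have "1 * (real d * \<eta>) \<le> C2 * real d * real d * (real d * \<eta>)"
    using \<eta> by (intro mult_right_mono) auto
  then have "real d * \<eta> \<le> C2 * (real d)\<^sup>2 * (real d * \<eta>)"
    by (simp only: power2_eq_square mult.assoc mult_1)
  then have d\<eta>1: "real d * \<eta> \<le> 1" using d\<eta> \<kappa>' by linarith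
  have "real d * \<eta>\<^sup>2 \<le> (real d * \<eta>)\<^sup>2"
    using d \<eta> by (simp add: power_mult_distrib power2_eq_square)
  then have "(real d * \<eta>\<^sup>2) powr (p / 2) \<le> ((real d * \<eta>)\<^sup>2) powr (p / 2)"
    using p by (intro powr_mono2) auto
  also have "\<dots> = (real d * \<eta>) powr p" using \<eta> by (simp add: power2_powr_half)
  also have "\<dots> \<le> (real d * \<eta>) powr 1" using p d\<eta>1 \<eta> d by (intro powr_mono') auto
  finally have \<theta>: "(real d * \<eta>\<^sup>2) powr (p / 2) \<le> real d * \<eta>" using \<eta> by simp
  have "d * (1 + 8 * C * L) * (real d * \<eta>\<^sup>2) powr (p / 2) \<le> C2 * (real d)\<^sup>2 * (real d * \<eta>)"
    using C2_ge by (intro mult_mono[OF T2 \<theta>]) auto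
  then have small2: "d * (1 + 8 * C * L) * (real d * \<eta>\<^sup>2) powr (p / 2) \<le> \<kappa> / 64"
    using d\<eta> \<kappa>' by linarith
  have "real d * (real d * \<eta>\<^sup>2) powr (p / 2) \<le> C2 * (real d)\<^sup>2 * (real d * \<eta>)"
  proof (intro mult_mono \<theta>)
    have "1 * real d \<le> (C2 * real d) * real d" using \<open>1 * 1 \<le> C2 * real d\<close> by (intro mult_right_mono) auto
    then show "real d \<le> C2 * (real d)\<^sup>2" by (simp add: power2_eq_square mult.assoc)
  qed (use C2_ge in auto)
  then have small1: "real d * (real d * \<eta>\<^sup>2) powr (p / 2) \<le> 1 / 8"
    using d\<eta> \<kappa>' by linarith
  define m where "m = \<lceil>6 / \<eta> + 1\<rceil>"
  have m: "6 / \<eta> + 1 \<le> real_of_int m" by (simp add: m_def)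
  have "0 < 6 / \<eta>" using \<eta> by simp
  then have "0 < real_of_int m" using m by linarith
  then have m0: "0 \<le> m" by simp
  \<comment> \<open>Since \<open>2 * m + 1 \<le> 12 / \<eta> + 5\<close> and
    \<open>12 * 64 = 768\<close>, the factor is \<open>773 = 768 + 5\<close>.\<close>
  define C5 where "C5 = 773 * 306 * C\<^sup>2 / \<kappa>'"
  have C5: "C5 * \<omega> = 773 * C2 / \<kappa>'" by (simp add: C5_def C2_def)
  have C2\<kappa>: "C2 \<le> C2 / \<kappa>'" using \<kappa>' C2_ge by (simp add: field_simps mult_left_le)
  then have C5_ge: "1 \<le> C5 * \<omega>" unfolding C5 using C2_ge by simp
  have "2 * real_of_int m + 1 \<le> 12 / \<eta> + 5" unfolding m_def by linarith
  also have "12 / \<eta> = 768 * (C2 / \<kappa>' * real d ^ 3)" by (simp add: \<eta>_def)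
  also have "5 \<le> 5 * (C2 / \<kappa>' * real d ^ 3)"
  proof -
    have "1 * 1 \<le> C2 / \<kappa>' * real d ^ 3"
      using C2\<kappa> C2_ge d by (intro mult_mono) auto
    then show ?thesis by simp
  qed
  finally have m_le: "2 * real_of_int m + 1 \<le> C5 * \<omega> * real d ^ 3" by (simp add: C5)
  have "C5 * \<omega> * real d ^ 3 = exp (ln (C5 * \<omega>) + 3 * l)"
    using C5_ge d by (simp add: exp_add l_def exp_of_nat_mult[of 3, simplified])
  then have "(2 * real_of_int m + 1) ^ d \<le> exp (ln (C5 * \<omega>) + 3 * l) ^ d"
    using m_le m0 by (intro power_mono) auto
  also have "\<dots> = exp (d * (ln (C5 * \<omega>) + 3 * l))" by (simp add: exp_of_nat_mult)
  finally have count: "(2 * real_of_int m + 1) ^ d \<le> exp (d * (ln (C5 * \<omega>) + 3 * l))" .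
  have "exp (- (\<kappa> * s)) \<le> exp (- (\<kappa> * (\<omega> * real d * l)))" using s_ge \<kappa> by simp
  with count have "(2 * real_of_int m + 1) ^ d * exp (- (\<kappa> * s))
      \<le> exp (d * (ln (C5 * \<omega>) + 3 * l)) * exp (- (\<kappa> * (\<omega> * real d * l)))"
    by (intro mult_mono) auto
  also have "\<dots> = exp (d * (ln (C5 * \<omega>) + 3 * l - \<kappa> * \<omega> * l))"
    by (simp add: algebra_simps flip: exp_add)
  also have "\<dots> \<le> exp (- 2)"
  proof -
    \<comment> \<open>The net costs \<open>ln (C5 * \<omega>) + 3 * l\<close> per coordinate. In
      \<open>large\<close> the 5 splits into 3 for the cubic mesh and 2 for a surplus of
      \<open>2 * l\<close>, which over \<open>d\<close> coordinates is at least 2.\<close>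
    have "ln (C5 * \<omega>) * (1 / 2) \<le> ln (C5 * \<omega>) * l" using C5_ge l by (intro mult_left_mono) auto
    then have "ln (C5 * \<omega>) + 3 * l - \<kappa> * \<omega> * l \<le> (2 * ln (C5 * \<omega>) + 3 - \<kappa> * \<omega>) * l"
      by (simp add: algebra_simps)
    also have "\<dots> \<le> - 2 * l"
      using large l by (intro mult_right_mono) (auto simp: C5_def \<kappa>'_def)
    finally have "real d * (ln (C5 * \<omega>) + 3 * l - \<kappa> * \<omega> * l) \<le> real d * (- 2 * l)"
      by (intro mult_left_mono) auto
    also have "\<dots> \<le> - 2" using dl by simp
    finally show ?thesis by simp
  qed
  also have "exp (- 2) \<le> (1 / 4 :: real)"
  proof -
    have "(2 :: real)\<^sup>2 \<le> exp 1 ^ 2" using exp_ge_add_one_self[of "1 :: real"] by (intro power_mono) auto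
    also have "exp 1 ^ 2 = exp (2 :: real)" by (simp flip: exp_of_nat_mult)
    finally show ?thesis by (simp add: exp_minus field_simps)
  qed
  finally have fine: "(2 * real_of_int m + 1) ^ d * exp (- (\<kappa> * s)) \<le> 1 / 4" .
  show "\<exists>L m \<eta>. 4 * C * s \<le> 2 ^ L \<and> 0 < \<eta> \<and> 6 / \<eta> + 1 \<le> real_of_int m \<and> 0 \<le> m \<and>
      d * (1 + 8 * C * L) \<le> 306 * C\<^sup>2 * \<omega> * (real d * ln (real d)) \<and>
      real d * (real d * \<eta>\<^sup>2) powr (p / 2) \<le> 1 / 8 \<and>
      d * (1 + 8 * C * L) * (real d * \<eta>\<^sup>2) powr (p / 2) \<le> \<kappa> / 64 \<and>
      (2 * real_of_int m + 1) ^ d * exp (- (\<kappa> * s)) \<le> 1 / 4"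
    using L_ge \<eta> m m0 T[unfolded C2_def l_def] small1 small2 fine by blast
qed

subsection \<open>The oblivious embedding\<close>

text \<open>Off the two bad events the argument is deterministic. The contraction constant depends
  only on \<open>\<kappa>\<close> and \<open>p\<close>, while the dilation constant combines the
  energy bound for the sketched matrix with the factor 6 from the position of \<open>U\<close>. The
  \<open>p\<close>-th roots are taken at the very end, together with the division by
  \<open>s\<close>.\<close>

lemma stable_sketch_distortion:
  fixes \<omega> :: real
  assumes D: "standard_stable p D" and p: "1 \<le> p" "p \<le> 2"
    and A: "A \<in> carrier_mat n d" and rank: "vec_space.rank n A = d" and d: "2 \<le> d"
    and \<kappa>: "\<kappa> = - ln (laplace p D) / 2" and C: "C = 2 * gauss_moment p + 1"
    and \<omega>: "1 \<le> \<omega>" and large: "2 * ln (773 * 306 * C\<^sup>2 / min \<kappa> 1 * \<omega>) + 5 \<le> \<kappa> * \<omega>"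
    and s: "s = nat \<lceil>\<omega> * real d * ln (real d)\<rceil>"
  shows "1 / 4 \<le> \<P>(g in iid_entries D s n. \<forall>x\<in>carrier_vec d.
      1 / (64 / \<kappa>) powr (1 / p) * lp_norm p (A *\<^sub>v x)
        \<le> real s powr (- 1 / p) * lp_norm p (mat s n g * A *\<^sub>v x) \<and>
      real s powr (- 1 / p) * lp_norm p (mat s n g * A *\<^sub>v x)
        \<le> (6 * (306 * C\<^sup>2 * \<omega>)) powr (1 / p) * (real d * ln (real d)) powr (1 / p) * lp_norm p (A *\<^sub>v x))"
    (is "_ \<le> measure ?M ?G")
proof -
  interpret D: real_distribution D using D by (rule standard_stable_real_distribution)
  interpret M: prob_space ?M using D by (rule prob_space_iid_entries)
  have p0: "0 < p" using p by simp
  have \<kappa>0: "0 < \<kappa>" using laplace_bounds[OF D] by (simp add: \<kappa>)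
  have C1: "1 \<le> C" using gauss_moment_nonneg[of p] by (simp add: C)
  note params = sketch_parameters[OF \<kappa>0 C1 p(1) d \<omega> large s]
  note s0 = params(1) and dl = params(3)
  obtain L m \<eta> where L: "4 * C * s \<le> 2 ^ L" and \<eta>: "0 < \<eta>" "6 / \<eta> + 1 \<le> real_of_int m" "0 \<le> m"
    and T: "d * (1 + 8 * C * L) \<le> 306 * C\<^sup>2 * \<omega> * (real d * ln (real d))"
    and small: "real d * (real d * \<eta>\<^sup>2) powr (p / 2) \<le> 1 / 8"
      "d * (1 + 8 * C * L) * (real d * \<eta>\<^sup>2) powr (p / 2) \<le> \<kappa> / 64"
    and fine: "(2 * real_of_int m + 1) ^ d * exp (- (\<kappa> * s)) \<le> 1 / 4"
    using params(4) by blast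
  obtain U where U: "U \<in> carrier_mat n d"
    and AU: "\<And>x. x \<in> carrier_vec d \<Longrightarrow> \<exists>y\<in>carrier_vec d. A *\<^sub>v x = U *\<^sub>v y"
    and EU': "(\<Sum>i<n. row_sq U i powr (p / 2)) \<le> real d"
    and cond': "\<And>y. (\<Sum>j<d. (y j)\<^sup>2) powr (p / 2) \<le> 6 * (\<Sum>i<n. \<bar>row_form U i y\<bar> powr p)"
    using Lewis_basis[OF A rank p0 p(2)] d by auto
  have EU: "energy p U \<le> real d" using EU' U by (simp add: energy_def)
  have cond: "(\<Sum>j<d. (y j)\<^sup>2) powr (p / 2) \<le> 6 * lp_form p U y" for y
    using cond'[of y] U by (simp add: lp_form_def)
  \<comment> \<open>Without rows the form would vanish identically, against its lower bound at the
    all-ones vector.\<close>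
  have n0: "0 < n"
  proof (rule ccontr)
    assume "\<not> 0 < n"
    then show False using cond'[of "\<lambda>_. 1"] d by simp
  qed
  define E1 where "E1 = {g \<in> space ?M. real s * (real d * (1 + 8 * C * L)) < energy p (mat s n g * U)}"
  define E2 where "E2 = {g \<in> space ?M. \<exists>z. (\<forall>j<d. \<bar>z j\<bar> \<le> m) \<and>
      lp_form p (mat s n g * U) (\<lambda>j. \<eta> * of_int (z j)) < \<kappa> * real s * lp_form p U (\<lambda>j. \<eta> * of_int (z j))}"
  have d0: "0 < d" using d by simp
  have P1: "measure ?M E1 \<le> 1 / 2"
    unfolding E1_def by (rule energy_sketch_bound[OF D p0 p(2) U EU d0 s0 C L])
  have "measure ?M E2 \<le> (2 * of_int m + 1) ^ d * exp (- (\<kappa> * s))"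
    unfolding E2_def \<kappa> by (rule net_lower_bound(1)[OF D p0 s0 n0 U \<eta>(3)])
  with fine have P2: "measure ?M E2 \<le> 1 / 4" by linarith
  have "(\<lambda>g. \<Sum>k<s. (\<Sum>j<d. (\<Sum>i<n. g (k, i) * U $$ (i, j))\<^sup>2) powr (p / 2)) \<in> borel_measurable ?M"
    unfolding iid_entries_def by measurable
  then have "(\<lambda>g. energy p (mat s n g * U)) \<in> borel_measurable ?M"
    by (simp add: energy_def row_sq_mat_mult[OF U])
  then have S1: "E1 \<in> sets ?M" unfolding E1_def by measurable
  have S2: "E2 \<in> sets ?M"
    unfolding E2_def \<kappa> by (rule net_lower_bound(2)[OF D p0 s0 n0 U \<eta>(3)])
  have "1 / 4 \<le> 1 - measure ?M (E1 \<union> E2)" using P1 P2 measure_Un_le[OF S1 S2] by linarith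
  also have "\<dots> = measure ?M (space ?M - (E1 \<union> E2))"
    by (rule M.prob_compl[OF sets.Un[OF S1 S2], symmetric])
  also have "\<dots> \<le> measure ?M ?G"
  proof (rule M.finite_measure_mono)
    show "?G \<in> sets ?M" by (rule distortion_event_measurable[OF D p0 A])
    show "space ?M - (E1 \<union> E2) \<subseteq> ?G"
    proof (intro subsetI CollectI conjI ballI)
      fix g assume g: "g \<in> space ?M - (E1 \<union> E2)"
      then show "g \<in> space ?M" by simp
      let ?Z = "mat s n g * U"
      have Z: "?Z \<in> carrier_mat s d" by (rule mult_carrier_mat[OF mat_carrier U])
      have EZ: "energy p ?Z \<le> real s * (real d * (1 + 8 * C * L))"
        using g by (auto simp: E1_def not_less)
      have net: "\<kappa> * real s * lp_form p U (\<lambda>j. \<eta> * of_int (z j)) \<le> lp_form p ?Z (\<lambda>j. \<eta> * of_int (z j))"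
        if "\<And>j. j < d \<Longrightarrow> \<bar>z j\<bar> \<le> m" for z
      proof (rule ccontr)
        assume "\<not> ?thesis"
        then have "g \<in> E2" unfolding E2_def not_le using g that by blast
        with g show False by blast
      qed
      fix x :: "real Matrix.vec" assume "x \<in> carrier_vec d"
      then obtain y where y: "y \<in> carrier_vec d" and xy: "A *\<^sub>v x = U *\<^sub>v y" using AU by blast
      have "mat s n g * A *\<^sub>v x = mat s n g *\<^sub>v (A *\<^sub>v x)"
        by (rule assoc_mult_mat_vec[OF mat_carrier A \<open>x \<in> carrier_vec d\<close>])
      also have "\<dots> = ?Z *\<^sub>v y"
        unfolding xy by (rule assoc_mult_mat_vec[OF mat_carrier U y, symmetric])
      finally have Zx: "lp_norm p (mat s n g * A *\<^sub>v x) = lp_form p ?Z (vec_index y) powr (1 / p)"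
        by (simp only: lp_norm_mult_vec[OF Z y])
      have Ux: "lp_norm p (A *\<^sub>v x) = lp_form p U (vec_index y) powr (1 / p)"
        unfolding xy by (rule lp_norm_mult_vec[OF U y])
      let ?u = "lp_form p U (vec_index y)" and ?z = "lp_form p ?Z (vec_index y)"
      have scale: "real s powr (- 1 / p) * ?z powr (1 / p) = (?z / real s) powr (1 / p)"
        using s0 by (simp add: powr_divide powr_minus_divide)
      have "\<kappa> / 64 * real s * ?u \<le> ?z"
        by (rule lp_form_lower_bound_from_net[OF p U Z EU EZ cond net \<eta>(1,2) \<kappa>0 small])
      then have "?u / (64 / \<kappa>) \<le> ?z / real s" using s0 \<kappa>0 by (simp add: field_simps)
      then have "(?u / (64 / \<kappa>)) powr (1 / p) \<le> (?z / real s) powr (1 / p)"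
        using p0 \<kappa>0 by (intro powr_mono2) auto
      then show "1 / (64 / \<kappa>) powr (1 / p) * lp_norm p (A *\<^sub>v x)
          \<le> real s powr (- 1 / p) * lp_norm p (mat s n g * A *\<^sub>v x)"
        unfolding Zx Ux scale using \<kappa>0 by (simp add: powr_divide powr_mult mult.commute)
      have E0: "0 \<le> energy p ?Z" by (simp add: energy_def sum_nonneg)
      \<comment> \<open>The dilation holds at every vector directly, through the energy; the net
        serves the contraction only.\<close>
      have "?z \<le> energy p ?Z * (\<Sum>j<d. (vec_index y j)\<^sup>2) powr (p / 2)"
        using lp_form_le_energy[of p ?Z "vec_index y"] p0 carrier_matD(2)[OF Z] by simp
      also have "\<dots> \<le> (real s * (306 * C\<^sup>2 * \<omega> * (real d * ln (real d)))) * (6 * ?u)"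
      proof (rule mult_mono[OF order_trans[OF EZ] cond])
        show "real s * (real d * (1 + 8 * C * L)) \<le> real s * (306 * C\<^sup>2 * \<omega> * (real d * ln (real d)))"
          using T by (intro mult_left_mono) auto
        show "0 \<le> real s * (306 * C\<^sup>2 * \<omega> * (real d * ln (real d)))"
          using \<omega> dl by simp
      qed simp
      finally have "?z / real s \<le> (6 * (306 * C\<^sup>2 * \<omega>)) * (real d * ln (real d)) * ?u"
        using s0 by (simp add: field_simps)
      then have "(?z / real s) powr (1 / p) \<le> ((6 * (306 * C\<^sup>2 * \<omega>)) * (real d * ln (real d)) * ?u) powr (1 / p)"
        using p0 by (intro powr_mono2) auto
      also have "\<dots> = (6 * (306 * C\<^sup>2 * \<omega>)) powr (1 / p) * (real d * ln (real d)) powr (1 / p) * ?u powr (1 / p)"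
        using \<omega> dl by (simp only: powr_mult)
      finally show "real s powr (- 1 / p) * lp_norm p (mat s n g * A *\<^sub>v x)
          \<le> (6 * (306 * C\<^sup>2 * \<omega>)) powr (1 / p) * (real d * ln (real d)) powr (1 / p) * lp_norm p (A *\<^sub>v x)"
        unfolding Zx Ux scale .
    qed
  qed
  finally show ?thesis .
qed

text \<open>The time bound is purely multiplicative in the number of nonzero entries, so the fixed
  overhead of the program is charged to at least one such entry.\<close>

lemma nnz_pos_of_full_rank:
  assumes A: "A \<in> carrier_mat n d" and rank: "vec_space.rank n A = d" and d: "0 < d"
  shows "0 < nnz A"
proof (rule ccontr)
  assume "\<not> 0 < nnz A"
  moreover have "finite (nonzero_entries A)"
    by (rule finite_subset[of _ "{..<dim_row A} \<times> {..<dim_col A}"]) (auto simp: nonzero_entries_def)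
  ultimately have "nonzero_entries A = {}" by (simp add: nnz_def)
  then have "A = 0\<^sub>m n d" using A by (auto simp: nonzero_entries_def intro!: eq_matI)
  then show False using rank d by (simp add: vec_space.rank_0I)
qed

theorem theorem6:
  fixes p :: real and D :: "real measure"
  assumes "1 < p" and "p < 2" and "standard_stable p D"
  shows "\<exists>\<omega>\<^sub>0>0. \<exists>P. \<forall>\<omega>\<ge>\<omega>\<^sub>0. \<exists>c>0. \<exists>C>0. \<exists>\<delta>>0. \<exists>K>0.
    \<forall>(n::nat) (d::nat) (A::real mat).
      2 \<le> d \<longrightarrow> A \<in> carrier_mat n d \<longrightarrow> vec_space.rank n A = d \<longrightarrow>
      (let s = nat \<lceil>\<omega> * real d * ln (real d)\<rceil> in
        \<P>(g in iid_entries D s n. \<forall>x\<in>carrier_vec d.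
            1 / c * lp_norm p (A *\<^sub>v x)
              \<le> real s powr (- 1 / p) * lp_norm p (mat s n g * A *\<^sub>v x) \<and>
            real s powr (- 1 / p) * lp_norm p (mat s n g * A *\<^sub>v x)
              \<le> C * (real d * ln (real d)) powr (1 / p) * lp_norm p (A *\<^sub>v x)) \<ge> \<delta> \<and>
        (\<forall>S\<in>carrier_mat s n.
            multiplies_within P S A (K * real (nnz A) * (real d * ln (real d)))))"
proof -
  note D = assms(3)
  have p: "1 \<le> p" "p \<le> 2" using assms by auto
  define \<kappa> where "\<kappa> = - ln (laplace p D) / 2"
  define B where "B = 2 * gauss_moment p + 1"
  have \<kappa>0: "0 < \<kappa>" using laplace_bounds[OF D] by (simp add: \<kappa>_def)
  have B1: "1 \<le> B" using gauss_moment_nonneg[of p] by (simp add: B_def)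
  have "0 < 773 * 306 * B\<^sup>2 / min \<kappa> 1" using \<kappa>0 B1 by (intro divide_pos_pos mult_pos_pos) auto
  then obtain \<omega>\<^sub>0 where \<omega>\<^sub>0: "1 \<le> \<omega>\<^sub>0"
    and large: "\<And>\<omega>. \<omega>\<^sub>0 \<le> \<omega> \<Longrightarrow> 2 * ln (773 * 306 * B\<^sup>2 / min \<kappa> 1 * \<omega>) + 5 \<le> \<kappa> * \<omega>"
    using log_le_linear[OF _ \<kappa>0] by blast
  show ?thesis
  proof (rule exI[of _ \<omega>\<^sub>0], intro conjI exI[of _ sparse_mult_prog] allI impI)
    show "0 < \<omega>\<^sub>0" using \<omega>\<^sub>0 by simp
    fix \<omega> assume "\<omega>\<^sub>0 \<le> \<omega>"
    then have \<omega>: "1 \<le> \<omega>" and large\<omega>: "2 * ln (773 * 306 * B\<^sup>2 / min \<kappa> 1 * \<omega>) + 5 \<le> \<kappa> * \<omega>"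
      using \<omega>\<^sub>0 large by auto
    show "\<exists>c>0. \<exists>C>0. \<exists>\<delta>>0. \<exists>K>0.
      \<forall>(n::nat) (d::nat) (A::real mat).
      2 \<le> d \<longrightarrow> A \<in> carrier_mat n d \<longrightarrow> vec_space.rank n A = d \<longrightarrow>
      (let s = nat \<lceil>\<omega> * real d * ln (real d)\<rceil> in
        \<P>(g in iid_entries D s n. \<forall>x\<in>carrier_vec d.
            1 / c * lp_norm p (A *\<^sub>v x)
              \<le> real s powr (- 1 / p) * lp_norm p (mat s n g * A *\<^sub>v x) \<and>
            real s powr (- 1 / p) * lp_norm p (mat s n g * A *\<^sub>v x)
              \<le> C * (real d * ln (real d)) powr (1 / p) * lp_norm p (A *\<^sub>v x)) \<ge> \<delta> \<and>
        (\<forall>S\<in>carrier_mat s n.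
            multiplies_within sparse_mult_prog S A (K * real (nnz A) * (real d * ln (real d)))))"
    proof (rule exI[of _ "(64 / \<kappa>) powr (1 / p)"], intro conjI,
        goal_cases)
      case 1
      show ?case using \<kappa>0 by simp
    next
      case 2
      have C: "0 < (6 * (306 * B\<^sup>2 * \<omega>)) powr (1 / p)" using B1 \<omega> by simp
      \<comment> \<open>The bound \<open>s \<le> 2 * \<omega> * (d * ln d)\<close> turns the 7 steps
        per row into \<open>14 * \<omega>\<close>. The 9 is the per-entry overhead 7 plus the fixed
        cost 2, both absorbed by \<open>1 \<le> d * ln d\<close>.\<close>
      have K: "0 < 14 * \<omega> + 9" using \<omega> by simp
      show ?case
      proof (rule exI[of _ "(6 * (306 * B\<^sup>2 * \<omega>)) powr (1 / p)"], rule conjI[OF C],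
          rule exI[of _ "1 / 4"], rule conjI, simp, rule exI[of _ "14 * \<omega> + 9"], rule conjI[OF K],
          unfold Let_def, intro allI impI conjI ballI)
        fix n d :: nat and A :: "real mat"
        assume d: "2 \<le> d" and A: "A \<in> carrier_mat n d" and rank: "vec_space.rank n A = d"
        define s where "s = nat \<lceil>\<omega> * real d * ln (real d)\<rceil>"
        show "1 / 4 \<le> \<P>(g in iid_entries D (nat \<lceil>\<omega> * real d * ln (real d)\<rceil>) n. \<forall>x\<in>carrier_vec d.
            1 / (64 / \<kappa>) powr (1 / p) * lp_norm p (A *\<^sub>v x)
              \<le> real (nat \<lceil>\<omega> * real d * ln (real d)\<rceil>) powr (- 1 / p)
                * lp_norm p (mat (nat \<lceil>\<omega> * real d * ln (real d)\<rceil>) n g * A *\<^sub>v x) \<and>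
            real (nat \<lceil>\<omega> * real d * ln (real d)\<rceil>) powr (- 1 / p)
                * lp_norm p (mat (nat \<lceil>\<omega> * real d * ln (real d)\<rceil>) n g * A *\<^sub>v x)
              \<le> (6 * (306 * B\<^sup>2 * \<omega>)) powr (1 / p) * (real d * ln (real d)) powr (1 / p) * lp_norm p (A *\<^sub>v x))"
          unfolding s_def[symmetric]
          by (rule stable_sketch_distortion[OF D p A rank d \<kappa>_def B_def \<omega> large\<omega> s_def])
        fix S :: "real mat"
        assume "S \<in> carrier_mat (nat \<lceil>\<omega> * real d * ln (real d)\<rceil>) n"
        then have S: "S \<in> carrier_mat s n" by (simp only: s_def)
        have s_le: "real s \<le> 2 * \<omega> * (real d * ln (real d))" and dl: "1 \<le> real d * ln (real d)"
          using sketch_parameters(2,3)[OF \<kappa>0 B1 p(1) d \<omega> large\<omega> s_def] by auto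
        have nnz: "1 \<le> real (nnz A)" using nnz_pos_of_full_rank[OF A rank] d by simp
        have "real (nnz A) * (7 * real s + 7) + 2 \<le> real (nnz A) * (7 * real s + 7) + real (nnz A) * 2"
          using nnz by simp
        also have "\<dots> = real (nnz A) * (7 * real s + 9)" by (simp add: algebra_simps)
        also have "\<dots> \<le> real (nnz A) * ((14 * \<omega> + 9) * (real d * ln (real d)))"
          using s_le dl by (intro mult_left_mono) (auto simp: algebra_simps)
        finally have time: "real (nnz A) * (7 * real s + 7) + 2 \<le> (14 * \<omega> + 9) * real (nnz A) * (real d * ln (real d))"
          by (simp only: mult_ac)
        show "multiplies_within sparse_mult_prog S A ((14 * \<omega> + 9) * real (nnz A) * (real d * ln (real d)))"
          by (rule multiplies_within_mono[OF sparse_mult_correct[OF S A] time])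
      qed
    qed
  qed
qed

end
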